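(* Let $P=\sum_{j=1}^{m}a_j(x)y^{v_j}\in\mathbb{C}[x,y,y^{-1}]$ satisfy $P=con(P)$, and suppose $P$ is factorized as $P=C\,y^{p}P_1^{r_1}\cdots P_n^{r_n}$, where $C\in\mathbb{C}$, $p\in\mathbb{Z}$, and $P_1,\dots,P_n\in\mathbb{C}[x,y]$ are square-free and pairwise co-prime. Then for each $i\in\{1,\dots,n\}$: 1) there exist $C_i\in\mathbb{C}$ and $p_i\in\mathbb{Z}$ such that $P_i=C_i\,y^{p_i}\,con(P_i)$; 2) the function $f_i(x)=LRhom(P_i\,y^{-p_i/2}\,C_i^{-1/2})$ is real-valued or pure imaginary; $f_i$ has no multiple root other than $0$ for $i=1,\dots,n$, and $f_i$ and $f_j$ have no common root other than $0$ for $i\neq j$; 3) $LRhom(P)=C_0f_1^{r_1}\cdots f_n^{r_n}$, where $C_0=C\,C_1^{r_1/2}\cdots C_n^{r_n/2}$.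
   Context: $I$ denotes the imaginary unit. Elements of $\mathbb{C}[x,y,y^{-1}]$ are written $P=\sum_{j}a_j(x)y^{v_j}$ with $a_j\in\mathbb{C}[x]$, $v_j\in\mathbb{Z}$. The conjugate of $P$ is $con(P)=\sum_j\overline{a_j}(x)\,y^{-v_j}$, where $\overline{a_j}$ is the conjugate of $a_j$ (for real $x$, $\overline{a_j}(x)=\overline{a_j(x)}$). $LRhom(P)$ is the function of the real variable $x$ obtained by substituting $y=e^{Ix}$: $LRhom(P)=\sum_j a_j(x)(\cos(v_jx)+I\sin(v_jx))$; the same formula is used when the exponents $v_j$ are half-integers, i.e. $y^{k/2}\mapsto e^{Ikx/2}$. $C_i^{1/2}$ denotes a fixed square root of $C_i$, and $C_i^{-1/2}=1/C_i^{1/2}$, $C_i^{r/2}=(C_i^{1/2})^{r}$.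
   Formalization: P is assumed nonzero and the r_i pairwise distinct and at least 1; the no-multiple-root and no-common-root claims are made only when P has algebraic coefficients. Otherwise they fail, e.g. for (x+Iy)(x-I/y), or for sin x minus its tangent line at 1. *)

theory Defs
  imports
    Complex_Main
    "HOL-Library.Poly_Mapping"
    "HOL-Computational_Algebra.Computational_Algebra"
begin

text \<open>
  A finitely supported map \<open>P :: rat \<Rightarrow>\<^sub>0 complex poly\<close> stands for the finite sum of the terms
  \<open>a\<^sub>v(x) y\<^sup>v\<close>, where \<open>a\<^sub>v = lookup P v\<close>; the product is convolution. Rational exponents are
  admitted so that the half-integral powers of \<open>y\<close> and the integral ones live in one ring.
\<close>

type_synonym gen_laurent = "rat \<Rightarrow>\<^sub>0 complex poly"

text \<open>The subring \<open>\<complex>[x, y, 1/y]\<close>.\<close>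

definition laurent_polys :: "gen_laurent set" where
  "laurent_polys = {P. Poly_Mapping.keys P \<subseteq> \<int>}"

definition const_L :: "complex \<Rightarrow> gen_laurent" where
  "const_L c = Poly_Mapping.single 0 [:c:]"

definition y_pow :: "rat \<Rightarrow> gen_laurent" where
  "y_pow v = Poly_Mapping.single v 1"

text \<open>
  \<open>\<complex>[x, y]\<close> is \<open>complex poly poly\<close>, with \<open>y\<close> the outer and \<open>x\<close> the inner variable.
\<close>

definition of_bipoly :: "complex poly poly \<Rightarrow> gen_laurent" where
  "of_bipoly Q = (\<Sum>k\<le>degree Q. Poly_Mapping.single (of_nat k) (coeff Q k))"

definition con :: "gen_laurent \<Rightarrow> gen_laurent" where
  "con P = (\<Sum>v\<in>Poly_Mapping.keys P.
     Poly_Mapping.single (- v) (map_poly cnj (Poly_Mapping.lookup P v)))"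

text \<open>Recall that \<open>cis t = cos t + \<i> sin t\<close>.\<close>

definition LRhom :: "gen_laurent \<Rightarrow> real \<Rightarrow> complex" where
  "LRhom P x = (\<Sum>v\<in>Poly_Mapping.keys P.
     poly (Poly_Mapping.lookup P v) (complex_of_real x) * cis (of_rat v * x))"

text \<open>
  The assertions about nonzero roots rest on Lindemann's theorem and need algebraic coefficients:
  \<open>sin x - (cos 1 * (x - 1) + sin 1)\<close> is the image of an irreducible polynomial (up to a unit)
  but has the double root \<open>1\<close>.
\<close>

definition algebraic_coeffs :: "gen_laurent \<Rightarrow> bool" where
  "algebraic_coeffs P \<longleftrightarrow> (\<forall>v k. algebraic (coeff (Poly_Mapping.lookup P v) k))"

definition multiple_root :: "(real \<Rightarrow> complex) \<Rightarrow> real \<Rightarrow> bool" where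
  "multiple_root f x \<longleftrightarrow> f x = 0 \<and> (f has_vector_derivative 0) (at x)"

end

theory Submission
  imports
    Defs
    "HOL-Computational_Algebra.Field_as_Ring"
    "Jordan_Normal_Form.Char_Poly"
begin

text \<open>
  Comparing multiplicities of irreducible factors in \<open>P = con P\<close> (the exponents \<open>r i\<close> are distinct) shows that
  each \<open>Q i\<close> agrees with its conjugate up to a unit \<open>c y\<^bsup>q\<^esup>\<close>, where \<open>c * cnj c = 1\<close>; dividing by half of this unit
  gives a fixed point of \<open>con\<close>, whose image is real, and the halves combine to \<open>y\<^bsup>p\<^esup>\<close>.

  A multiple zero \<open>x\<close> of \<open>f i\<close> is a common zero, at the point \<open>(x, cis x)\<close>, of \<open>Q i\<close> and its image under
  the derivation \<open>x \<mapsto> 1\<close>, \<open>y \<mapsto> \<i> y\<close>. The only irreducible polynomial dividing its own image is \<open>y\<close>, so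
  these two polynomials have no relevant common factor. If the coefficients of \<open>P\<close> are algebraic, then so are those of
  a multiple of \<open>Q i\<close>, and both \<open>x\<close> and \<open>cis x\<close> are algebraic; the Hermite--Lindemann theorem gives \<open>x = 0\<close>.
  Common zeros of \<open>f i\<close> and \<open>f j\<close> are handled in the same way. For the Hermite--Lindemann theorem, an integral
  relation between powers of \<open>exp \<alpha>\<close> is multiplied over the conjugates of \<open>\<alpha>\<close> and by its image under
  negation of exponents, which makes the coefficient at the exponent \<open>0\<close> a positive sum of squares.
\<close>

subsection \<open>Sums of coefficients times characters\<close>

text \<open>Distinct exponents \<open>r i\<close> tie conjugation to each single factor: in P =
  y^(-1) (y - 2) (1 - 2 y), where both exponents are 1, conjugation exchanges the two factors. The
  prime y needs separate treatment, because it is a unit among Laurent polynomials and its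
  multiplicities on the two sides of \<open>P = con P\<close> carry no information.

  Algebraicity is given for the coefficients of P, while the factors may be rescaled by
  transcendental constants. Kronecker's substitution reduces this to one variable, where a factor is
  determined up to a constant by its zeros.

  In the exponential part, expanding a product over the conjugates of \<alpha> produces exponents
  that may coincide and coefficients that may cancel. Integrality is therefore expressed through the
  power moments \<open>\<Sum> t g * g ^ n\<close> and read off from formal power series, where
  coincidences do no harm; the product does not vanish because complex power series form an integral
  domain.\<close>

lemma poly_mapping_single_induct [case_names zero single]:
  assumes "P 0" and "\<And>v a Q. P Q \<Longrightarrow> P (Poly_Mapping.single v a + Q)"
  shows "P (Q :: 'a \<Rightarrow>\<^sub>0 'b::comm_monoid_add)"
proof (induction Q rule: update_induct)
  case (update f v a)
  have "Poly_Mapping.update v a f = Poly_Mapping.single v a + f"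
    using update(1) by (intro poly_mapping_eqI)
      (auto simp: lookup_update lookup_add lookup_single when_def not_in_keys_iff_lookup_eq_zero)
  then show ?case using assms(2) update.IH by metis
qed (rule assms(1))

text \<open>\<open>con\<close>, \<open>LRhom\<close> and the evaluations at \<open>exp\<close> and
  \<open>fps_exp\<close> in the proof of Hermite--Lindemann all have this shape, so multiplicativity
  is proved once.\<close>

definition pm_eval :: "('b \<Rightarrow> 'c) \<Rightarrow> ('a \<Rightarrow> 'c) \<Rightarrow> ('a \<Rightarrow>\<^sub>0 'b::zero) \<Rightarrow> 'c::comm_ring_1" where
  "pm_eval \<phi> \<chi> P = (\<Sum>v\<in>Poly_Mapping.keys P. \<phi> (Poly_Mapping.lookup P v) * \<chi> v)"

locale pm_eval_hom =
  fixes \<phi> :: "'b::comm_ring_1 \<Rightarrow> 'c::comm_ring_1" and \<chi> :: "'a::comm_monoid_add \<Rightarrow> 'c"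
  assumes add: "\<phi> (a + b) = \<phi> a + \<phi> b" and mult: "\<phi> (a * b) = \<phi> a * \<phi> b" and one: "\<phi> 1 = 1"
    and chi_zero: "\<chi> 0 = 1" and chi_add: "\<chi> (v + w) = \<chi> v * \<chi> w"
begin

lemma zero: "\<phi> 0 = 0"
  using add[of 0 0] by simp

lemma eval_superset:
  assumes "finite A" "Poly_Mapping.keys P \<subseteq> A"
  shows "pm_eval \<phi> \<chi> P = (\<Sum>v\<in>A. \<phi> (Poly_Mapping.lookup P v) * \<chi> v)"
  unfolding pm_eval_def using assms
  by (intro sum.mono_neutral_left) (auto simp: in_keys_iff zero)

lemma eval_zero [simp]: "pm_eval \<phi> \<chi> 0 = 0"
  by (simp add: pm_eval_def)

lemma eval_single [simp]: "pm_eval \<phi> \<chi> (Poly_Mapping.single v a) = \<phi> a * \<chi> v"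
  by (subst eval_superset[of "{v}"]) auto

lemma eval_one [simp]: "pm_eval \<phi> \<chi> 1 = 1"
  using eval_single[of 0 1] by (simp add: one chi_zero)

lemma eval_add: "pm_eval \<phi> \<chi> (P + Q) = pm_eval \<phi> \<chi> P + pm_eval \<phi> \<chi> Q"
proof -
  let ?A = "Poly_Mapping.keys P \<union> Poly_Mapping.keys Q"
  have "Poly_Mapping.keys (P + Q) \<subseteq> ?A" by (rule keys_add)
  then show ?thesis
    by (simp add: eval_superset[of ?A] lookup_add add distrib_right sum.distrib)
qed

lemma eval_sum: "pm_eval \<phi> \<chi> (\<Sum>i\<in>I. F i) = (\<Sum>i\<in>I. pm_eval \<phi> \<chi> (F i))"
  by (induction I rule: infinite_finite_induct) (auto simp: eval_add)

lemma eval_mult: "pm_eval \<phi> \<chi> (P * Q) = pm_eval \<phi> \<chi> P * pm_eval \<phi> \<chi> Q"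
proof (induction P rule: poly_mapping_single_induct)
  case (single v a P)
  have "pm_eval \<phi> \<chi> (Poly_Mapping.single v a * Q) = \<phi> a * \<chi> v * pm_eval \<phi> \<chi> Q"
    by (induction Q rule: poly_mapping_single_induct)
       (simp_all add: distrib_left eval_add mult_single mult chi_add mult_ac)
  then show ?case by (simp add: distrib_right eval_add single)
qed simp

lemma eval_prod: "pm_eval \<phi> \<chi> (\<Prod>i\<in>I. F i) = (\<Prod>i\<in>I. pm_eval \<phi> \<chi> (F i))"
  by (induction I rule: infinite_finite_induct) (auto simp: eval_mult)

lemma eval_power: "pm_eval \<phi> \<chi> (P ^ n) = pm_eval \<phi> \<chi> P ^ n"
  by (induction n) (auto simp: eval_mult)

end

subsection \<open>Algebraic numbers\<close>

interpretation rat_vs: vector_space "\<lambda>(q::rat) (z::'a::field_char_0). of_rat q * z"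
  by unfold_locales (simp_all add: algebra_simps of_rat_add of_rat_mult)

text \<open>A spanning set of a finite-dimensional algebra over the rationals. Such algebras play
  the part of number fields: finite dimension is what makes elements algebraic.\<close>

definition rat_subalgebra :: "'a::field_char_0 set \<Rightarrow> bool" where
  "rat_subalgebra S \<longleftrightarrow> finite S \<and> 1 \<in> rat_vs.span S \<and> (\<forall>s\<in>S. \<forall>t\<in>S. s * t \<in> rat_vs.span S)"

lemma span_mult_right:
  assumes "x \<in> rat_vs.span S" and "\<And>s. s \<in> S \<Longrightarrow> s * y \<in> rat_vs.span T"
  shows "x * y \<in> rat_vs.span T"
  using assms(1)
proof (induction rule: rat_vs.span_induct_alt)
  case base show ?case by (simp add: rat_vs.span_zero)
next
  case (step c s z)
  have "(of_rat c * s + z) * y = of_rat c * (s * y) + z * y" by (simp add: algebra_simps)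
  then show ?case using step assms(2) by (simp add: rat_vs.span_add rat_vs.span_scale)
qed

lemma span_mult_mem:
  assumes "x \<in> rat_vs.span S" "y \<in> rat_vs.span T"
    and "\<And>s t. s \<in> S \<Longrightarrow> t \<in> T \<Longrightarrow> s * t \<in> rat_vs.span U"
  shows "x * y \<in> rat_vs.span U"
proof (rule span_mult_right[OF assms(1)])
  fix s assume s: "s \<in> S"
  have "y * s \<in> rat_vs.span U"
    by (rule span_mult_right[OF assms(2)]) (subst mult.commute, rule assms(3)[OF s])
  then show "s * y \<in> rat_vs.span U" by (subst mult.commute)
qed

lemma rat_subalgebra_mult:
  "rat_subalgebra S \<Longrightarrow> x \<in> rat_vs.span S \<Longrightarrow> y \<in> rat_vs.span S \<Longrightarrow> x * y \<in> rat_vs.span S"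
  by (rule span_mult_mem[where S = S and T = S]) (auto simp: rat_subalgebra_def)

lemma rat_subalgebra_power:
  "rat_subalgebra S \<Longrightarrow> x \<in> rat_vs.span S \<Longrightarrow> x ^ n \<in> rat_vs.span S"
  by (induction n) (auto intro: rat_subalgebra_mult simp: rat_subalgebra_def)

text \<open>The \<open>card S + 1\<close> powers up to exponent \<open>card S\<close> lie in a space
  of dimension at most \<open>card S\<close>. If two of them coincide, their difference is already a
  relation; otherwise linear dependence supplies one.\<close>

lemma rat_subalgebra_algebraic:
  fixes x :: "'a::field_char_0"
  assumes S: "rat_subalgebra S" and x: "x \<in> rat_vs.span S"
  shows "algebraic x"
proof -
  let ?n = "card S"
  have fin: "finite S" using S by (simp add: rat_subalgebra_def)
  show ?thesis
  proof (cases "inj_on (\<lambda>i. x ^ i) {..?n}")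
    case False
    then obtain i j where ij: "i < j" "x ^ i = x ^ j"
      by (metis inj_onI linorder_neqE_nat)
    let ?p = "monom 1 j - monom 1 i :: 'a poly"
    have "coeff ?p j = 1" using ij by simp
    then have "?p \<noteq> 0" by (metis coeff_0 zero_neq_one)
    then show ?thesis by (intro algebraicI'[of ?p]) (use ij in \<open>simp_all add: poly_monom\<close>)
  next
    case True
    let ?X = "(\<lambda>i. x ^ i) ` {..?n}"
    have "?X \<subseteq> rat_vs.span S" using rat_subalgebra_power[OF S x] by auto
    then have "rat_vs.dependent ?X"
      using rat_vs.independent_span_bound[OF fin, of ?X] True by (auto simp: card_image)
    then obtain u where u: "\<exists>v\<in>?X. u v \<noteq> 0" "(\<Sum>v\<in>?X. of_rat (u v) * v) = 0"
      by (subst (asm) rat_vs.dependent_finite) auto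
    define p where "p = (\<Sum>i\<le>?n. monom (of_rat (u (x ^ i)) :: 'a) i)"
    have c: "coeff p k = (if k \<le> ?n then of_rat (u (x ^ k)) else 0)" for k
      by (simp add: p_def coeff_sum)
    have "poly p x = (\<Sum>i\<le>?n. of_rat (u (x ^ i)) * x ^ i)"
      by (simp add: p_def poly_sum poly_monom)
    also have "\<dots> = 0" using u(2) True by (simp add: sum.reindex)
    finally have "poly p x = 0" .
    moreover from u(1) obtain i where "i \<le> ?n" "u (x ^ i) \<noteq> 0" by auto
    then have "coeff p i \<noteq> 0" by (simp add: c)
    then have "p \<noteq> 0" by auto
    ultimately show ?thesis by (intro algebraicI'[of p]) (auto simp: c)
  qed
qed

text \<open>The monic relation rewrites x^n through lower powers, so the products
  \<open>s * x ^ i\<close> with \<open>i < n\<close> suffice. The coefficients of \<open>p\<close>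
  come from the span, not from the rationals; this gives closure under roots of polynomials with
  algebraic coefficients.\<close>

lemma rat_subalgebra_adjoin:
  fixes x :: "'a::field_char_0"
  assumes S: "rat_subalgebra S" and mon: "lead_coeff p = 1" and p: "\<And>i. coeff p i \<in> rat_vs.span S"
    and root: "poly p x = 0"
  obtains T where "rat_subalgebra T" "S \<subseteq> rat_vs.span T" "x \<in> rat_vs.span T"
proof -
  define n where "n = degree p"
  define T where "T = (\<lambda>(s, i). s * x ^ i) ` (S \<times> {..<n})"
  have n0: "n > 0"
  proof (rule ccontr)
    assume "\<not> n > 0"
    then obtain c where "p = [:c:]" unfolding n_def by (metis degree_eq_zeroE neq0_conv)
    then show False using mon root by auto
  qed
  have xn: "x ^ n = - (\<Sum>i<n. coeff p i * x ^ i)"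
  proof -
    have "0 = (\<Sum>i\<le>n. coeff p i * x ^ i)" using root by (simp add: poly_altdef n_def)
    also have "\<dots> = (\<Sum>i<n. coeff p i * x ^ i) + x ^ n"
      using mon by (simp add: lessThan_Suc_atMost[symmetric] n_def)
    finally show ?thesis by (simp add: eq_neg_iff_add_eq_0 add.commute)
  qed
  have fin: "finite S" and one: "1 \<in> rat_vs.span S" using S by (auto simp: rat_subalgebra_def)
  have main: "r * x ^ m \<in> rat_vs.span T" if "r \<in> rat_vs.span S" for r m
    using that
  proof (induction m arbitrary: r rule: less_induct)
    case (less m)
    show ?case
    proof (cases "m < n")
      case True
      then have "s * x ^ m \<in> rat_vs.span T" if "s \<in> S" for s
        using that by (intro rat_vs.span_base) (auto simp: T_def intro!: image_eqI[of _ _ "(s, m)"])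
      then show ?thesis using span_mult_right less.prems by blast
    next
      case False
      then have "r * x ^ m = r * (x ^ n * x ^ (m - n))" by (simp flip: power_add)
      also have "\<dots> = (\<Sum>i<n. - ((r * coeff p i) * x ^ (m - n + i)))"
        by (simp add: xn sum_distrib_left sum_distrib_right sum_negf power_add mult_ac)
      also have "\<dots> \<in> rat_vs.span T"
      proof (intro rat_vs.span_sum rat_vs.span_neg less.IH)
        fix i assume i: "i \<in> {..<n}"
        show "m - n + i < m" using i False by simp
        show "r * coeff p i \<in> rat_vs.span S" using rat_subalgebra_mult[OF S less.prems p] .
      qed
      finally show ?thesis .
    qed
  qed
  show ?thesis
  proof
    show "S \<subseteq> rat_vs.span T" using main[of _ 0] rat_vs.span_base by auto
    show "x \<in> rat_vs.span T" using main[of 1 1] one by auto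
    show "rat_subalgebra T" unfolding rat_subalgebra_def
    proof (intro conjI ballI)
      show "finite T" unfolding T_def using fin by auto
      show "1 \<in> rat_vs.span T" using main[of 1 0] one by auto
      fix a b assume "a \<in> T" "b \<in> T"
      then obtain s t i j where *: "s \<in> S" "t \<in> S" "a = s * x ^ i" "b = t * x ^ j"
        by (auto simp: T_def)
      have "a * b = (s * t) * x ^ (i + j)" by (simp add: * power_add mult_ac)
      then show "a * b \<in> rat_vs.span T"
        using main[OF rat_subalgebra_mult[OF S]] * rat_vs.span_base by metis
    qed
  qed
qed

lemma algebraic_imp_monic_rat:
  fixes x :: "'a::field_char_0"
  assumes "algebraic x"
  obtains p where "lead_coeff p = 1" "\<And>i. coeff p i \<in> \<rat>" "poly p x = 0"
proof -
  from assms obtain q where q: "\<And>i. coeff q i \<in> \<rat>" "q \<noteq> 0" "poly q x = 0"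
    by (auto simp: algebraic_altdef)
  show ?thesis
    by (rule that[of "Polynomial.smult (inverse (lead_coeff q)) q"]) (use q in auto)
qed

lemma Rats_in_span: "1 \<in> rat_vs.span S \<Longrightarrow> q \<in> \<rat> \<Longrightarrow> q \<in> rat_vs.span S"
  by (metis Rats_cases mult.right_neutral rat_vs.span_scale)

lemma rat_subalgebra_exists:
  fixes X :: "'a::field_char_0 set"
  assumes "finite X" "\<And>x. x \<in> X \<Longrightarrow> algebraic x"
  obtains S where "rat_subalgebra S" "X \<subseteq> rat_vs.span S"
  using assms
proof (induction X arbitrary: thesis rule: finite_induct)
  case empty
  show ?case by (rule empty(1)[of "{1}"]) (auto simp: rat_subalgebra_def intro: rat_vs.span_base)
next
  case (insert x X)
  obtain S where S: "rat_subalgebra S" "X \<subseteq> rat_vs.span S" using insert by auto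
  obtain p where p: "lead_coeff p = 1" "\<And>i. coeff p i \<in> \<rat>" "poly p x = 0"
    using algebraic_imp_monic_rat insert.prems(2) by blast
  have "coeff p i \<in> rat_vs.span S" for i
    using p(2) S(1) Rats_in_span by (auto simp: rat_subalgebra_def)
  then obtain T where T: "rat_subalgebra T" "S \<subseteq> rat_vs.span T" "x \<in> rat_vs.span T"
    using rat_subalgebra_adjoin[OF S(1) p(1) _ p(3)] by blast
  have "rat_vs.span S \<subseteq> rat_vs.span T" using T(2) by (simp add: rat_vs.span_minimal)
  then show ?case using insert.prems(1)[OF T(1)] T(3) S(2) by auto
qed

lemma algebraic_add:
  fixes x y :: "'a::field_char_0"
  assumes "algebraic x" "algebraic y"
  shows "algebraic (x + y)"
proof -
  obtain S where "rat_subalgebra S" "{x, y} \<subseteq> rat_vs.span S"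
    using rat_subalgebra_exists[of "{x, y}"] assms by auto
  then show ?thesis using rat_subalgebra_algebraic rat_vs.span_add by blast
qed

lemma algebraic_mult:
  fixes x y :: "'a::field_char_0"
  assumes "algebraic x" "algebraic y"
  shows "algebraic (x * y)"
proof -
  obtain S where "rat_subalgebra S" "{x, y} \<subseteq> rat_vs.span S"
    using rat_subalgebra_exists[of "{x, y}"] assms by auto
  then show ?thesis using rat_subalgebra_algebraic rat_subalgebra_mult by blast
qed

lemma algebraic_diff:
  "algebraic x \<Longrightarrow> algebraic y \<Longrightarrow> algebraic (x - y)" for x y :: "'a::field_char_0"
  using algebraic_add[of x "- y"] by simp

lemma algebraic_sum:
  "(\<And>i. i \<in> I \<Longrightarrow> algebraic (f i)) \<Longrightarrow> algebraic (\<Sum>i\<in>I. f i)" for f :: "'b \<Rightarrow> 'a::field_char_0"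
  by (induction I rule: infinite_finite_induct) (auto intro: algebraic_add)

lemma algebraic_root_algebraic_poly:
  fixes x :: "'a::field_char_0"
  assumes "p \<noteq> 0" "\<And>i. algebraic (coeff p i)" "poly p x = 0"
  shows "algebraic x"
proof -
  define q where "q = Polynomial.smult (inverse (lead_coeff p)) p"
  have q: "lead_coeff q = 1" "algebraic (coeff q i)" "poly q x = 0" for i
    using assms by (auto simp: q_def intro!: algebraic_mult)
  obtain S where S: "rat_subalgebra S" "coeff q ` {..degree q} \<subseteq> rat_vs.span S"
    using rat_subalgebra_exists[of "coeff q ` {..degree q}"] q(2) by auto
  have "coeff q i \<in> rat_vs.span S" for i
    using S(2) by (cases "i \<le> degree q") (auto simp: coeff_eq_0 rat_vs.span_zero)
  then show ?thesis
    using rat_subalgebra_adjoin[OF S(1) q(1) _ q(3)] rat_subalgebra_algebraic by metis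
qed

subsection \<open>Norms of polynomials in conjugates\<close>

definition is_subring :: "'a::comm_ring_1 set \<Rightarrow> bool" where
  "is_subring A \<longleftrightarrow> 1 \<in> A \<and> (\<forall>x\<in>A. \<forall>y\<in>A. x - y \<in> A \<and> x * y \<in> A)"

context
  fixes A :: "'a::comm_ring_1 set"
  assumes A: "is_subring A"
begin

lemma subring_one: "1 \<in> A" and subring_diff: "x \<in> A \<Longrightarrow> y \<in> A \<Longrightarrow> x - y \<in> A"
  and subring_mult: "x \<in> A \<Longrightarrow> y \<in> A \<Longrightarrow> x * y \<in> A"
  using A by (auto simp: is_subring_def)

lemma subring_zero: "0 \<in> A"
  using subring_diff[OF subring_one subring_one] by simp

lemma subring_uminus: "x \<in> A \<Longrightarrow> - x \<in> A"
  using subring_diff[OF subring_zero] by simp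

lemma subring_add: "x \<in> A \<Longrightarrow> y \<in> A \<Longrightarrow> x + y \<in> A"
  using subring_diff[of x "- y"] subring_uminus by simp

lemma subring_sum: "(\<And>i. i \<in> I \<Longrightarrow> f i \<in> A) \<Longrightarrow> (\<Sum>i\<in>I. f i) \<in> A"
  by (induction I rule: infinite_finite_induct) (auto intro: subring_zero subring_add)

lemma subring_prod: "(\<And>i. i \<in> I \<Longrightarrow> f i \<in> A) \<Longrightarrow> (\<Prod>i\<in>I. f i) \<in> A"
  by (induction I rule: infinite_finite_induct) (auto intro: subring_one subring_mult)

lemma subring_det:
  assumes M: "M \<in> carrier_mat n n" and "\<And>i j. i < n \<Longrightarrow> j < n \<Longrightarrow> M $$ (i, j) \<in> A"
  shows "det M \<in> A"
  unfolding det_def'[OF M]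
proof (rule subring_sum, rule subring_mult)
  fix p assume p: "p \<in> {p. p permutes {0..<n}}"
  show "signof p \<in> A" by (cases p rule: sign_cases) (auto intro: subring_one subring_uminus)
  show "(\<Prod>i=0..<n. M $$ (i, p i)) \<in> A"
    using p assms(2) by (intro subring_prod) (auto simp: permutes_in_image)
qed

end

text \<open>A nonzero vector killed by the transpose would list the coefficients of a polynomial of
  degree below \<open>d\<close> with \<open>d\<close> distinct zeros.\<close>

lemma det_vandermonde_nonzero:
  fixes b :: "nat \<Rightarrow> 'a::idom"
  assumes inj: "inj_on b {..<d}"
  shows "det (mat d d (\<lambda>(k, j). b j ^ k)) \<noteq> 0"
proof
  let ?V = "mat d d (\<lambda>(k, j). b j ^ k)"
  assume "det ?V = 0"
  then have "det (transpose_mat ?V) = 0" by (subst det_transpose[of _ d]) auto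
  then obtain v where v: "v \<in> carrier_vec d" "v \<noteq> 0\<^sub>v d" "transpose_mat ?V *\<^sub>v v = 0\<^sub>v d"
    using det_0_iff_vec_prod_zero[of "transpose_mat ?V" d] by auto
  define q where "q = (\<Sum>k<d. monom (vec_index v k) k)"
  have c: "coeff q k = (if k < d then vec_index v k else 0)" for k
    by (auto simp: q_def coeff_sum)
  have "q \<noteq> 0"
  proof
    assume "q = 0"
    then have "vec_index v k = 0" if "k < d" for k using c[of k] that by simp
    then show False using v(1,2) by (auto intro!: eq_vecI)
  qed
  have "poly q (b j) = 0" if "j < d" for j
  proof -
    have "0 = vec_index (transpose_mat ?V *\<^sub>v v) j" using v(3) that by simp
    also have "\<dots> = (\<Sum>k<d. b j ^ k * vec_index v k)"
      using that v(1) by (simp add: scalar_prod_def atLeast0LessThan)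
    finally show ?thesis by (simp add: q_def poly_sum poly_monom mult.commute)
  qed
  then have "b ` {..<d} \<subseteq> {x. poly q x = 0}" by auto
  then have "d \<le> card {x. poly q x = 0}"
    using card_mono[OF poly_roots_finite[OF \<open>q \<noteq> 0\<close>]] inj by (metis card_image card_lessThan)
  also have "\<dots> \<le> degree q" by (rule card_poly_roots_bound[OF \<open>q \<noteq> 0\<close>])
  finally have "coeff q (degree q) = 0" by (simp add: c)
  then show False using \<open>q \<noteq> 0\<close> by simp
qed

text \<open>
  The product is the determinant of multiplication by \<open>h\<close> modulo \<open>m\<close>, whose matrix has
  entries in \<open>A\<close> and is diagonalised over the larger ring by the Vandermonde matrix of the roots.
\<close>

lemma prod_poly_roots_mem:
  fixes b :: "nat \<Rightarrow> 'a::idom"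
  assumes A: "is_subring A" and inj: "inj_on b {..<d}"
    and m: "lead_coeff m = 1" "degree m = d" "\<And>i. coeff m i \<in> A" "\<And>i. i < d \<Longrightarrow> poly m (b i) = 0"
    and h: "\<And>i. coeff h i \<in> A"
  shows "(\<Prod>i<d. poly h (b i)) \<in> A"
proof -
  have bd: "b i ^ d = (\<Sum>j<d. - coeff m j * b i ^ j)" if "i < d" for i
  proof -
    have "0 = (\<Sum>j\<le>d. coeff m j * b i ^ j)" using m(2,4) that by (simp add: poly_altdef)
    also have "\<dots> = (\<Sum>j<d. coeff m j * b i ^ j) + b i ^ d"
      using m(1,2) by (simp add: lessThan_Suc_atMost[symmetric])
    finally show ?thesis by (simp add: eq_neg_iff_add_eq_0 add.commute sum_negf)
  qed
  \<comment> \<open>\<open>c\<close> lists the coefficients of the remainder of x^k modulo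
    \<open>m\<close>, found recursively: multiplication by x shifts them, and the overflow at degree
    \<open>d\<close> is replaced using \<open>bd\<close>.\<close>
  have "\<exists>c. (\<forall>j. c j \<in> A) \<and> (\<forall>i<d. b i ^ k = (\<Sum>j<d. c j * b i ^ j))" for k
  proof (induction k)
    case 0
    show ?case
      by (intro exI[of _ "\<lambda>j. if j = 0 then 1 else 0"])
         (auto simp: if_distrib[of "\<lambda>x. x * _"] subring_zero[OF A] subring_one[OF A] cong: if_cong)
  next
    case (Suc k)
    then obtain c where c: "\<And>j. c j \<in> A" "\<And>i. i < d \<Longrightarrow> b i ^ k = (\<Sum>j<d. c j * b i ^ j)" by blast
    show ?case
    proof (cases d)
      case 0
      then show ?thesis using c by auto
    next
      case (Suc e)
      let ?c = "\<lambda>j. (if j = 0 then 0 else c (j - 1)) - c e * coeff m j"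
      have "b i ^ Suc k = (\<Sum>j<d. ?c j * b i ^ j)" if i: "i < d" for i
      proof -
        have "b i ^ Suc k = (\<Sum>j<Suc e. c j * b i ^ Suc j)"
          by (simp add: c(2)[OF i] Suc sum_distrib_left mult_ac distrib_left)
        also have "\<dots> = (\<Sum>j<e. c j * b i ^ Suc j) + c e * b i ^ d" by (simp add: Suc)
        also have "(\<Sum>j<e. c j * b i ^ Suc j) = (\<Sum>j<d. (if j = 0 then 0 else c (j - 1)) * b i ^ j)"
          by (simp only: Suc sum.lessThan_Suc_shift) simp
        also have "c e * b i ^ d = (\<Sum>j<d. - (c e * coeff m j) * b i ^ j)"
          by (simp add: bd[OF i] sum_distrib_left mult_ac)
        finally show ?thesis by (simp add: sum.distrib[symmetric] left_diff_distrib)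
      qed
      moreover have "?c j \<in> A" for j
        using c(1) m(3) A by (auto intro!: subring_diff subring_uminus subring_mult subring_zero)
      ultimately show ?thesis by (intro exI[of _ ?c]) auto
    qed
  qed
  then obtain c where cA: "\<And>k j. c k j \<in> A"
    and c: "\<And>k i. i < d \<Longrightarrow> b i ^ k = (\<Sum>j<d. c k j * b i ^ j)" by metis
  \<comment> \<open>Row \<open>i\<close> holds the remainder of x^i times \<open>h\<close> modulo
    \<open>m\<close>; hence \<open>M\<close> maps the column of powers of \<open>b j\<close> to
    \<open>poly h (b j)\<close> times that column.\<close>
  define M where "M = mat d d (\<lambda>(i, j). \<Sum>e\<le>degree h. coeff h e * c (i + e) j)"
  define V where "V = mat d d (\<lambda>(k, j). b j ^ k)"
  define D where "D = mat_diag d (\<lambda>j. poly h (b j))"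
  have dims: "M \<in> carrier_mat d d" "V \<in> carrier_mat d d" "D \<in> carrier_mat d d"
    by (auto simp: M_def V_def D_def)
  have "M * V = V * D"
  proof (rule eq_matI)
    fix i j assume "i < dim_row (V * D)" "j < dim_col (V * D)"
    then have ij: "i < d" "j < d" using dims by auto
    have "(M * V) $$ (i, j) = (\<Sum>k<d. (\<Sum>e\<le>degree h. coeff h e * c (i + e) k) * b j ^ k)"
      using ij dims by (simp add: M_def V_def scalar_prod_def atLeast0LessThan)
    also have "\<dots> = (\<Sum>k<d. \<Sum>e\<le>degree h. coeff h e * (c (i + e) k * b j ^ k))"
      by (simp add: sum_distrib_right mult.assoc)
    also have "\<dots> = (\<Sum>e\<le>degree h. \<Sum>k<d. coeff h e * (c (i + e) k * b j ^ k))"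
      by (rule sum.swap)
    also have "\<dots> = (\<Sum>e\<le>degree h. coeff h e * b j ^ (i + e))"
      by (subst c[OF ij(2)]) (simp add: sum_distrib_left)
    also have "\<dots> = b j ^ i * poly h (b j)"
      by (simp add: poly_altdef sum_distrib_left power_add mult_ac)
    also have "\<dots> = (V * D) $$ (i, j)"
      using ij dims by (simp add: D_def mat_diag_mult_right[of _ d d] V_def)
    finally show "(M * V) $$ (i, j) = (V * D) $$ (i, j)" .
  qed (use dims in auto)
  then have "det M * det V = det V * det D"
    using det_mult dims by metis
  moreover have "det V \<noteq> 0" unfolding V_def by (rule det_vandermonde_nonzero[OF inj])
  moreover have "det D = (\<Prod>i<d. poly h (b i))"
    by (subst det_upper_triangular[of _ d])
       (auto simp: D_def mat_diag_def prod_list_diag_prod atLeast0LessThan)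
  moreover have "det M \<in> A"
    by (rule subring_det[OF A dims(1)])
       (auto simp: M_def intro!: subring_sum[OF A] subring_mult[OF A] h cA)
  ultimately show ?thesis by simp
qed

lemma Rats_common_denominator:
  fixes X :: "'a::field_char_0 set"
  assumes "finite X" "X \<subseteq> \<rat>"
  obtains a :: int where "a > 0" "\<And>x. x \<in> X \<Longrightarrow> of_int a * x \<in> \<int>"
  using assms
proof (induction X arbitrary: thesis rule: finite_induct)
  case empty show ?case using empty(1)[of 1] by auto
next
  case (insert x X)
  obtain a :: int where a: "a > 0" "\<And>x. x \<in> X \<Longrightarrow> of_int a * x \<in> \<int>" using insert by auto
  obtain n m :: int where x: "x = of_int n / of_int m" "m > 0"
    using insert.prems(2) by (auto elim!: Rats_cases')
  show ?case
  proof (rule insert.prems(1)[of "a * m"])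
    show "a * m > 0" using a x by simp
    fix y assume "y \<in> insert x X"
    then consider "y = x" | "y \<in> X" by blast
    then show "of_int (a * m) * y \<in> \<int>"
    proof cases
      case 1 then show ?thesis using x by simp
    next
      case 2
      have "of_int m * (of_int a * y) \<in> \<int>" by (rule Ints_mult[OF Ints_of_int a(2)[OF 2]])
      then show ?thesis by (simp add: mult_ac)
    qed
  qed
qed

text \<open>\<open>b\<close> lists the zeros of the minimal polynomial of \<alpha> over the
  rationals, which are simple by separability. A common denominator \<open>a\<close> turns them into
  algebraic integers \<open>of_int a * b i\<close>, the zeros of one monic integer
  polynomial.\<close>

lemma algebraic_conjugates:
  fixes \<alpha> :: complex
  assumes "algebraic \<alpha>" "\<alpha> \<noteq> 0"
  obtains b :: "nat \<Rightarrow> complex" and d :: nat and a :: int and m :: "complex poly"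
  where "a > 0" "inj_on b {..<d}" "\<alpha> \<in> b ` {..<d}" "\<And>i. i < d \<Longrightarrow> b i \<noteq> 0"
    "lead_coeff m = 1" "degree m = d" "\<And>i. coeff m i \<in> \<int>"
    "\<And>i. i < d \<Longrightarrow> poly m (of_int a * b i) = 0"
proof -
  let ?h = "map_poly of_rat :: rat poly \<Rightarrow> complex poly"
  interpret h: map_poly_inj_idom_hom "of_rat :: rat \<Rightarrow> complex" ..
  have "\<exists>q. q \<noteq> 0 \<and> poly (?h q) \<alpha> = 0"
  proof -
    obtain p :: "complex poly" where p: "\<And>i. coeff p i \<in> \<rat>" "p \<noteq> 0" "poly p \<alpha> = 0"
      using assms(1) by (auto simp: algebraic_altdef)
    have "\<forall>i. \<exists>c. coeff p i = of_rat c" using p(1) by (auto simp: Rats_def)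
    then obtain c where c: "\<And>i. coeff p i = of_rat (c i)" by (auto simp: choice_iff)
    have c0: "c i = 0" if "i > degree p" for i using c[of i] that by (simp add: coeff_eq_0)
    have "p = ?h (\<Sum>i\<le>degree p. monom (c i) i)"
      by (rule poly_eqI) (auto simp: coeff_map_poly coeff_sum c c0)
    then show ?thesis using p(2,3) by (metis map_poly_0)
  qed
  then obtain q0 where q0: "q0 \<noteq> 0 \<and> poly (?h q0) \<alpha> = 0" by blast
  \<comment> \<open>Minimal degree alone yields the form of irreducibility used below: in a
    factorisation of \<open>q\<close> one factor vanishes at \<alpha> and so has full
    degree.\<close>
  define q where "q = (ARG_MIN degree q. q \<noteq> 0 \<and> poly (?h q) \<alpha> = 0)"
  have q: "q \<noteq> 0" "poly (?h q) \<alpha> = 0"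
    using arg_min_natI[of "\<lambda>q. q \<noteq> 0 \<and> poly (?h q) \<alpha> = 0", OF q0, of degree] by (auto simp: q_def)
  have qmin: "degree q \<le> degree q'" if "q' \<noteq> 0" "poly (?h q') \<alpha> = 0" for q'
    unfolding q_def by (rule arg_min_nat_le) (use that in auto)
  have factor: "degree u = 0 \<or> degree v = 0" if "q = u * v" for u v
  proof -
    have nz: "u \<noteq> 0" "v \<noteq> 0" using q that by auto
    have "poly (?h u) \<alpha> = 0 \<or> poly (?h v) \<alpha> = 0" using q(2) that by (simp add: h.hom_mult)
    then have "degree q \<le> degree u \<or> degree q \<le> degree v" using qmin nz by blast
    then show ?thesis using that nz by (auto simp: degree_mult_eq)
  qed
  have degq: "degree q > 0"
  proof (rule ccontr)
    assume "\<not> degree q > 0"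
    then obtain c where "q = [:c:]" by (metis degree_eq_zeroE neq0_conv)
    then show False using q by (auto simp: map_poly_pCons)
  qed
  \<comment> \<open>A common divisor of \<open>q\<close> and its derivative has smaller degree than
    \<open>q\<close>, hence is constant by \<open>factor\<close>; a Bezout identity then excludes
    multiple zeros.\<close>
  have gcd1: "gcd q (pderiv q) = 1"
  proof -
    define g where "g = gcd q (pderiv q)"
    obtain v where v: "q = g * v" using gcd_dvd1[of q "pderiv q"] unfolding g_def dvd_def by blast
    have "pderiv q \<noteq> 0" using degq by (simp add: pderiv_eq_0_iff)
    then have "degree g \<le> degree (pderiv q)" by (simp add: g_def dvd_imp_degree_le)
    then have "degree g < degree q" using degq by (simp add: degree_pderiv)
    moreover have "degree q = degree g + degree v" using v q(1) by (subst v, subst degree_mult_eq) auto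
    ultimately have "degree g = 0" using factor[OF v] by auto
    then have "is_unit g" using q(1) by (simp add: is_unit_iff_degree g_def)
    then show ?thesis by (simp only: g_def is_unit_gcd_iff)
  qed
  obtain u v where uv: "u * q + v * pderiv q = 1"
    using bezout_coefficients_fst_snd[of q "pderiv q"] gcd1 by metis
  have hpd: "?h (pderiv q) = pderiv (?h q)"
    by (rule poly_eqI) (simp add: coeff_map_poly coeff_pderiv of_rat_mult of_rat_add)
  have simple: "rsquarefree (?h q)"
    unfolding rsquarefree_roots
  proof safe
    fix x assume x: "poly (?h q) x = 0" "poly (pderiv (?h q)) x = 0"
    have "?h u * ?h q + ?h v * pderiv (?h q) = 1"
      using arg_cong[OF uv, of ?h] by (simp add: h.hom_mult h.hom_add hpd)
    then have "poly (?h u * ?h q + ?h v * pderiv (?h q)) x = 1" by simp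
    then show False using x by simp
  qed
  define m0 where "m0 = Polynomial.smult (inverse (lead_coeff (?h q))) (?h q)"
  have hq0: "?h q \<noteq> 0" using q(1) by simp
  define d where "d = degree q"
  have dh: "degree (?h q) = d" by (simp add: d_def)
  have m0: "lead_coeff m0 = 1" "degree m0 = d" "\<And>i. coeff m0 i \<in> \<rat>"
    "\<And>x. poly m0 x = 0 \<longleftrightarrow> poly (?h q) x = 0"
    using hq0 by (auto simp: m0_def d_def)
  define Z where "Z = {x. poly (?h q) x = 0}"
  have finZ: "finite Z" unfolding Z_def using hq0 by (rule poly_roots_finite)
  have "d = degree (\<Prod>z\<in>Z. [:- z, 1:])"
    using arg_cong[OF complex_poly_decompose_rsquarefree[OF simple], of degree] hq0
    by (simp add: d_def Z_def)
  also have "\<dots> = card Z" by (subst degree_prod_sum_eq) auto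
  finally have "card Z = d" ..
  then obtain b where b: "bij_betw b {..<d} Z"
    using finZ by (metis atLeast0LessThan ex_bij_betw_nat_finite)
  obtain a :: int where a: "a > 0" "\<And>x. x \<in> coeff m0 ` {..d} \<Longrightarrow> of_int a * x \<in> \<int>"
    using Rats_common_denominator[of "coeff m0 ` {..d}"] m0(3) by blast
  \<comment> \<open>This is a^d m0(x/a). Every coefficient below the leading one has at least one
    factor \<open>a\<close>, which clears its denominator.\<close>
  define m where "m = (\<Sum>i\<le>d. monom (of_int a ^ (d - i) * coeff m0 i) i)"
  have cm: "coeff m i = (if i \<le> d then of_int a ^ (d - i) * coeff m0 i else 0)" for i
    by (auto simp: m_def coeff_sum)
  have lead0: "coeff m0 d = 1" using m0(1,2) by simp
  have degm: "degree m = d"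
    by (rule order_antisym[OF degree_le le_degree]) (auto simp: cm lead0)
  show ?thesis
  proof (rule that[of a b d m])
    show "a > 0" "inj_on b {..<d}" using a b by (auto simp: bij_betw_def)
    show "\<alpha> \<in> b ` {..<d}" using b q(2) by (auto simp: bij_betw_def Z_def)
    show "degree m = d" by (rule degm)
    show "lead_coeff m = 1" by (simp add: degm cm lead0)
    show "coeff m i \<in> \<int>" for i
    proof (cases "i < d")
      case True
      then have "d - i = Suc (d - i - 1)" by simp
      then have "coeff m i = of_int a ^ (d - i - 1) * (of_int a * coeff m0 i)"
        using True by (simp add: cm)
      also have "\<dots> \<in> \<int>"
        using True by (intro Ints_mult[OF _ a(2)] Ints_power) auto
      finally show ?thesis .
    qed (auto simp: cm lead0)
    fix i assume i: "i < d"
    have bZ: "b i \<in> Z" using b i by (auto simp: bij_betw_def)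
    have "poly m (of_int a * b i) = (\<Sum>j\<le>d. of_int a ^ d * (coeff m0 j * b i ^ j))"
      unfolding m_def poly_sum poly_monom
    proof (rule sum.cong[OF refl])
      fix j assume "j \<in> {..d}"
      then have "of_int a ^ d = (of_int a ^ (d - j) * of_int a ^ j :: complex)"
        by (simp flip: power_add)
      then show "of_int a ^ (d - j) * coeff m0 j * (of_int a * b i) ^ j = of_int a ^ d * (coeff m0 j * b i ^ j)"
        by (simp add: power_mult_distrib mult_ac)
    qed
    also have "\<dots> = of_int a ^ d * poly m0 (b i)"
      by (simp add: sum_distrib_left poly_altdef m0(2))
    also have "\<dots> = 0" using bZ by (simp add: m0(4) Z_def)
    finally show "poly m (of_int a * b i) = 0" .
    \<comment> \<open>A zero conjugate would split x off \<open>q\<close>, leaving a polynomial of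
      smaller degree that vanishes at \<alpha>, since \<alpha> is nonzero.\<close>
    show "b i \<noteq> 0"
    proof
      assume "b i = 0"
      then have "poly (?h q) 0 = 0" using bZ by (simp add: Z_def)
      then have "poly q 0 = 0" by (simp add: poly_0_coeff_0 coeff_map_poly)
      then obtain w where w: "q = [:0, 1:] * w" by (auto simp: poly_eq_0_iff_dvd elim: dvdE)
      have "?h q = [:0, 1:] * ?h w" unfolding w h.hom_mult by (simp add: map_poly_pCons)
      then have "poly (?h w) \<alpha> = 0" using q(2) assms(2) by simp
      moreover have "w \<noteq> 0" using w q(1) by auto
      ultimately have "degree q \<le> degree w" by (rule qmin[rotated])
      then show False using w \<open>w \<noteq> 0\<close> by simp
    qed
  qed
qed

subsection \<open>The Hermite--Lindemann theorem\<close>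

text \<open>A submultiplicative majorant of \<open>f\<close> on the disc of radius \<open>r\<close>;
  for Hermite's polynomial it gives a bound that is geometric in the prime \<open>p\<close>.\<close>

definition abs_poly_eval :: "complex poly \<Rightarrow> real \<Rightarrow> real" where
  "abs_poly_eval f r = (\<Sum>i\<le>degree f. norm (coeff f i) * r ^ i)"

lemma abs_poly_eval_altdef:
  "degree f \<le> n \<Longrightarrow> abs_poly_eval f r = (\<Sum>i\<le>n. norm (coeff f i) * r ^ i)"
  unfolding abs_poly_eval_def by (intro sum.mono_neutral_left) (auto simp: coeff_eq_0)

lemma abs_poly_eval_nonneg: "r \<ge> 0 \<Longrightarrow> abs_poly_eval f r \<ge> 0"
  unfolding abs_poly_eval_def by (intro sum_nonneg) auto

lemma abs_poly_eval_add:
  assumes "r \<ge> 0" shows "abs_poly_eval (f + g) r \<le> abs_poly_eval f r + abs_poly_eval g r"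
proof -
  let ?n = "max (degree f) (degree g)"
  show ?thesis using assms
    by (subst (1 2 3) abs_poly_eval_altdef[of _ ?n])
       (auto simp: degree_add_le sum.distrib[symmetric] distrib_right[symmetric]
             intro!: sum_mono mult_right_mono norm_triangle_ineq)
qed

lemma abs_poly_eval_0 [simp]: "abs_poly_eval 0 r = 0"
  by (simp add: abs_poly_eval_def)

lemma abs_poly_eval_pCons: "abs_poly_eval (pCons a f) r = norm a + r * abs_poly_eval f r"
proof -
  have "abs_poly_eval (pCons a f) r = (\<Sum>i\<le>Suc (degree f). norm (coeff (pCons a f) i) * r ^ i)"
    by (rule abs_poly_eval_altdef) (simp add: degree_pCons_le)
  then show ?thesis
    by (simp add: sum.atMost_Suc_shift abs_poly_eval_def sum_distrib_left mult_ac del: sum.atMost_Suc)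
qed

lemma abs_poly_eval_smult: "abs_poly_eval (Polynomial.smult a f) r = norm a * abs_poly_eval f r"
  by (subst abs_poly_eval_altdef[of _ "degree f"])
     (auto simp: abs_poly_eval_def norm_mult sum_distrib_left mult_ac)

lemma abs_poly_eval_mult:
  assumes r: "r \<ge> 0" shows "abs_poly_eval (f * g) r \<le> abs_poly_eval f r * abs_poly_eval g r"
proof (induction f)
  case (pCons a f)
  have "abs_poly_eval (pCons a f * g) r \<le> norm a * abs_poly_eval g r + r * abs_poly_eval (f * g) r"
    using abs_poly_eval_add[OF r, of "Polynomial.smult a g" "pCons 0 (f * g)"]
    by (simp add: abs_poly_eval_smult abs_poly_eval_pCons)
  also have "\<dots> \<le> norm a * abs_poly_eval g r + r * (abs_poly_eval f r * abs_poly_eval g r)"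
    using pCons.IH r by (intro add_left_mono mult_left_mono) auto
  finally show ?case by (simp add: abs_poly_eval_pCons algebra_simps)
qed simp

lemma abs_poly_eval_power:
  assumes r: "r \<ge> 0" shows "abs_poly_eval (f ^ n) r \<le> abs_poly_eval f r ^ n"
proof (induction n)
  case 0 show ?case by (simp add: abs_poly_eval_def)
next
  case (Suc n)
  have "abs_poly_eval (f ^ Suc n) r \<le> abs_poly_eval f r * abs_poly_eval (f ^ n) r"
    using abs_poly_eval_mult[OF r] by simp
  also have "\<dots> \<le> abs_poly_eval f r * abs_poly_eval f r ^ n"
    using Suc abs_poly_eval_nonneg[OF r] by (intro mult_left_mono) auto
  finally show ?case by simp
qed

text \<open>
  \<open>hermite_sum f z\<close> is the sum of all derivatives of \<open>f\<close> at \<open>z\<close>; the \<open>k\<close>-th derivative is \<open>k!\<close>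
  times the \<open>k\<close>-th coefficient of \<open>f (x + z)\<close>.
\<close>

definition hermite_sum :: "complex poly \<Rightarrow> complex \<Rightarrow> complex" where
  "hermite_sum f z = (\<Sum>k\<le>degree f. fact k * coeff (pcompose f [:z, 1:]) k)"

lemma coeff_pcompose_shift:
  fixes f :: "'a::comm_ring_1 poly"
  shows "coeff (pcompose f [:z, 1:]) k =
    (\<Sum>n\<le>degree f. coeff f n * (of_nat (n choose k) * z ^ (n - k)))"
proof -
  have "pcompose f [:z, 1:] = (\<Sum>n\<le>degree f. Polynomial.smult (coeff f n) ([:z, 1:] ^ n))"
    by (simp add: pcompose_altdef poly_altdef coeff_map_poly degree_map_poly)
  moreover have "coeff ([:z, 1:] ^ n) k = of_nat (n choose k) * z ^ (n - k)" for n
  proof (cases "k \<le> n")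
    case False
    then show ?thesis using degree_power_le[of "[:z, 1:]" n] by (simp add: coeff_eq_0 binomial_eq_0)
  qed (simp add: coeff_linear_poly_power)
  ultimately show ?thesis by (simp add: coeff_sum)
qed

text \<open>Since k! (n choose k) = n!/(n-k)!, the monomial x^n contributes n! times a partial sum
  of the exponential series; this is where \<open>exp\<close> enters.\<close>

lemma hermite_sum_altdef:
  "hermite_sum f z = (\<Sum>n\<le>degree f. coeff f n * (fact n * (\<Sum>j\<le>n. z ^ j / fact j)))"
proof -
  have "fact n * (\<Sum>j\<le>n. z ^ j / fact j) = (\<Sum>k\<le>degree f. fact k * (of_nat (n choose k) * z ^ (n - k)))"
    if "n \<le> degree f" for n
  proof -
    have "fact n * (\<Sum>j\<le>n. z ^ j / fact j) = (\<Sum>j\<le>n. fact n * (z ^ j / fact j))"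
      by (simp add: sum_distrib_left)
    also have "\<dots> = (\<Sum>k\<le>n. fact n * (z ^ (n - k) / fact (n - k)))"
      using sum.nat_diff_reindex[of "\<lambda>j. fact n * (z ^ j / fact j)" "Suc n"]
      by (simp add: lessThan_Suc_atMost)
    also have "\<dots> = (\<Sum>k\<le>n. fact k * (of_nat (n choose k) * z ^ (n - k)))"
      by (intro sum.cong) (auto simp: binomial_fact)
    also have "\<dots> = (\<Sum>k\<le>degree f. fact k * (of_nat (n choose k) * z ^ (n - k)))"
      using that by (intro sum.mono_neutral_left) auto
    finally show ?thesis .
  qed
  then have "(\<Sum>n\<le>degree f. coeff f n * (fact n * (\<Sum>j\<le>n. z ^ j / fact j))) =
      (\<Sum>n\<le>degree f. \<Sum>k\<le>degree f. fact k * (coeff f n * (of_nat (n choose k) * z ^ (n - k))))"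
    by (intro sum.cong) (auto simp: sum_distrib_left mult_ac)
  also have "\<dots> = hermite_sum f z"
    by (subst sum.swap) (simp add: hermite_sum_def coeff_pcompose_shift sum_distrib_left)
  finally show ?thesis by simp
qed

text \<open>The tail term of index j + n + 1 is compared, up to the factor |z|^n, with the term of
  index j + 1 of the series for |z|, by n! (j+1)! \<le> (n+j+1)!.\<close>

lemma norm_exp_partial_sum:
  fixes z :: complex
  shows "norm (fact n * ((\<Sum>j\<le>n. z ^ j / fact j) - exp z)) \<le> norm z ^ n * exp (norm z)"
proof -
  have s: "(\<lambda>j. z ^ j / fact j) sums exp z"
    using exp_converges[of z] by (simp add: scaleR_conv_of_real field_simps)
  from sums_split_initial_segment[OF s, of "Suc n"]
  have t: "(\<lambda>j. z ^ (j + Suc n) / fact (j + Suc n)) sums (exp z - (\<Sum>j\<le>n. z ^ j / fact j))"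
    by (simp add: lessThan_Suc_atMost)
  have bnd: "norm (fact n * (z ^ (j + Suc n) / fact (j + Suc n))) \<le> norm z ^ n * (norm z ^ Suc j / fact (Suc j))" for j
  proof -
    have "(fact n * fact (Suc j) :: nat) \<le> fact (j + Suc n)"
      using dvd_imp_le[OF fact_fact_dvd_fact[of n "Suc j"]] by (simp add: add.commute)
    then have le: "(fact n * fact (Suc j) :: real) \<le> fact (j + Suc n)"
      by (metis of_nat_fact of_nat_le_iff of_nat_mult)
    have "fact n / fact (j + Suc n) \<le> (1 / fact (Suc j) :: real)"
      using le by (simp only: divide_simps) (auto simp: mult_ac)
    then have "norm z ^ (j + Suc n) * (fact n / fact (j + Suc n)) \<le> norm z ^ (j + Suc n) * (1 / fact (Suc j))"
      by (intro mult_left_mono) auto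
    moreover have "norm (fact n * (z ^ (j + Suc n) / fact (j + Suc n))) = norm z ^ (j + Suc n) * (fact n / fact (j + Suc n))"
      by (simp add: norm_mult norm_divide norm_power del: fact_Suc)
    moreover have "norm z ^ (j + Suc n) * (1 / fact (Suc j)) = norm z ^ n * (norm z ^ Suc j / fact (Suc j))"
      by (simp add: power_add del: fact_Suc)
    ultimately show ?thesis by (simp only:)
  qed
  have e: "(\<lambda>j. norm z ^ j / fact j) sums exp (norm z)"
    using exp_converges[of "norm z"] by (simp add: field_simps)
  from sums_split_initial_segment[OF e, of 1]
  have e': "(\<lambda>j. norm z ^ Suc j / fact (Suc j)) sums (exp (norm z) - 1)" by simp
  have "norm (fact n * (exp z - (\<Sum>j\<le>n. z ^ j / fact j))) \<le> norm z ^ n * (exp (norm z) - 1)"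
    using norm_sums_le[OF sums_mult[OF t] sums_mult[OF e'] bnd] .
  also have "\<dots> \<le> norm z ^ n * exp (norm z)" by (intro mult_left_mono) auto
  finally show ?thesis by (simp only: norm_mult norm_minus_commute[of "exp z"])
qed

text \<open>Up to sign the difference is Hermite's integral of exp (z - u) f(u) from 0 to z. It is
  estimated through series: at 0 every partial sum equals 1, so only tails of the exponential series
  remain.\<close>

lemma norm_hermite_sum_diff:
  assumes "norm z \<le> r"
  shows "norm (hermite_sum f z - exp z * hermite_sum f 0) \<le> exp (norm z) * abs_poly_eval f r"
proof -
  have 0: "(\<Sum>j\<le>n. 0 ^ j / fact j) = (1 :: complex)" for n
    by (subst sum.remove[of _ 0]) (auto intro!: sum.neutral)
  have "hermite_sum f z - exp z * hermite_sum f 0 =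
     (\<Sum>n\<le>degree f. coeff f n * (fact n * ((\<Sum>j\<le>n. z ^ j / fact j) - exp z)))"
    by (simp add: hermite_sum_altdef 0 sum_distrib_left sum_subtractf[symmetric] algebra_simps)
  also have "norm \<dots> \<le> (\<Sum>n\<le>degree f. norm (coeff f n) * (r ^ n * exp (norm z)))"
  proof (rule sum_norm_le)
    fix n
    have "norm (fact n * ((\<Sum>j\<le>n. z ^ j / fact j) - exp z)) \<le> r ^ n * exp (norm z)"
      using norm_exp_partial_sum[of n z] power_mono[OF assms, of n]
      by (meson mult_right_mono exp_ge_zero norm_ge_zero order_trans)
    then show "norm (coeff f n * (fact n * ((\<Sum>j\<le>n. z ^ j / fact j) - exp z)))
        \<le> norm (coeff f n) * (r ^ n * exp (norm z))"
      unfolding norm_mult[of "coeff f n"] by (intro mult_left_mono) auto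
  qed
  also have "\<dots> = exp (norm z) * abs_poly_eval f r"
    by (simp add: abs_poly_eval_def sum_distrib_left mult_ac)
  finally show ?thesis .
qed

lemma coeff_pcompose_shift_eq_0:
  fixes f :: "complex poly"
  assumes "[:- z, 1:] ^ p dvd f" "k < p"
  shows "coeff (pcompose f [:z, 1:]) k = 0"
proof -
  obtain u where "f = [:- z, 1:] ^ p * u" using assms(1) by (elim dvdE)
  moreover have "pcompose (g ^ n) h = pcompose g h ^ n" for g h :: "complex poly" and n
    by (induction n) (simp_all add: pcompose_mult pcompose_1)
  ultimately have "pcompose f [:z, 1:] = monom 1 p * pcompose u [:z, 1:]"
    by (simp add: pcompose_mult pcompose_pCons monom_altdef)
  then show ?thesis using assms(2) by (simp add: coeff_monom_mult)
qed


text \<open>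
  Hermite's argument: for \<open>f = x\<^bsup>p-1\<^esup> \<Theta>\<^bsup>p\<^esup>\<close> with \<open>\<Theta>\<close> vanishing at the nonzero exponents, the number
  \<open>\<Sum> t\<^sub>\<gamma> hermite_sum f \<gamma> / (p-1)!\<close> is, up to the power of \<open>a\<close>, an integer not divisible
  by the prime \<open>p\<close>, and it is small if \<open>\<Sum> t\<^sub>\<gamma> exp \<gamma> = 0\<close>.
\<close>

lemma exp_sum_nonzero:
  fixes t :: "complex \<Rightarrow> int" and a :: int
  assumes fin: "finite G" and G0: "0 \<in> G" "t 0 \<noteq> 0" and alg: "\<And>g. g \<in> G \<Longrightarrow> algebraic g"
    and a: "a > 0" and mom: "\<And>n. of_int a ^ n * (\<Sum>g\<in>G. of_int (t g) * g ^ n) \<in> \<int>"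
  shows "(\<Sum>g\<in>G. of_int (t g) * exp g) \<noteq> 0"
proof
  assume eq0: "(\<Sum>g\<in>G. of_int (t g) * exp g) = 0"
  \<comment> \<open>The nonzero constant terms make \<open>c0\<close>, and with it the coefficient
    of \<open>f\<close> at \<open>p - 1\<close>, nonzero.\<close>
  have "\<exists>q::int poly. coeff q 0 \<noteq> 0 \<and> poly (map_poly of_int q) g = 0" if "g \<in> G - {0}" for g
    using algebraicE'_nonzero[of g] alg that by blast
  then obtain q :: "complex \<Rightarrow> int poly" where
    q: "\<And>g. g \<in> G - {0} \<Longrightarrow> coeff (q g) 0 \<noteq> 0 \<and> poly (map_poly of_int (q g)) g = 0" by metis
  let ?h = "map_poly of_int :: int poly \<Rightarrow> complex poly"
  have hmult: "?h (f * g) = ?h f * ?h g" for f g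
    by (intro poly_eqI) (simp add: coeff_map_poly coeff_mult)
  have hprod: "?h (\<Prod>i\<in>I. F i) = (\<Prod>i\<in>I. ?h (F i))" for F :: "complex \<Rightarrow> int poly" and I
    by (induction I rule: infinite_finite_induct) (auto simp: hmult)
  have hpow: "?h (f ^ n) = ?h f ^ n" for f n
    by (induction n) (auto simp: hmult)
  define \<Theta> where "\<Theta> = (\<Prod>g\<in>G-{0}. q g)"
  define c0 where "c0 = coeff \<Theta> 0"
  have c0: "c0 \<noteq> 0"
    unfolding c0_def \<Theta>_def using q fin by (simp add: poly_0_coeff_0[symmetric] poly_prod)
  have root: "[:- g, 1:] dvd ?h \<Theta>" if "g \<in> G - {0}" for g
  proof -
    have "?h (q g) dvd ?h \<Theta>" unfolding \<Theta>_def hprod using that fin by (intro dvd_prodI) auto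
    moreover have "[:- g, 1:] dvd ?h (q g)" using q[OF that] by (simp add: poly_eq_0_iff_dvd)
    ultimately show ?thesis by (rule dvd_trans[rotated])
  qed
  define m where "m = degree \<Theta>"
  define r where "r = Max (insert 1 (norm ` G))"
  have r: "r \<ge> 1" "\<And>g. g \<in> G \<Longrightarrow> norm g \<le> r" unfolding r_def using fin by auto
  define B where "B = abs_poly_eval (?h \<Theta>) r"
  have B0: "B \<ge> 0" unfolding B_def using r by (intro abs_poly_eval_nonneg) auto
  define W where "W = (\<Sum>g\<in>G. \<bar>of_int (t g)\<bar> * exp (norm g))"
  have W0: "W \<ge> 0" unfolding W_def by (intro sum_nonneg) auto
  \<comment> \<open>Chosen independent of \<open>p\<close>, so that factorials overtake
    \<open>W * L ^ p\<close>. The exponent \<open>Suc m\<close> comes from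
    \<open>D = p - 1 + p * m\<close>, which is at most \<open>Suc m * p\<close>.\<close>
  define L where "L = of_int a ^ Suc m * (r * B)"
  have L0: "L \<ge> 0" unfolding L_def using a r B0 by auto
  have key: "fact (p - 1) \<le> W * L ^ p"
    if p: "prime p" "int p > \<bar>a\<bar>" "int p > \<bar>t 0\<bar>" "int p > \<bar>c0\<bar>" for p :: nat
  proof -
    have p0: "p > 0" using p(1) prime_gt_0_nat by blast
    define f0 where "f0 = monom 1 (p - 1) * \<Theta> ^ p"
    define f where "f = ?h f0"
    have f_eq: "f = monom 1 (p - 1) * ?h \<Theta> ^ p"
      by (simp add: f_def f0_def hmult hpow map_poly_monom)
    define D where "D = p - 1 + p * m"
    have degf: "degree f \<le> D"
    proof -
      have "degree f \<le> degree f0" by (simp add: f_def degree_map_poly)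
      also have "\<dots> \<le> degree (monom 1 (p - 1) :: int poly) + degree (\<Theta> ^ p)"
        unfolding f0_def by (rule degree_mult_le)
      also have "\<dots> \<le> p - 1 + m * p"
        using degree_power_le[of \<Theta> p] by (simp add: degree_monom_eq m_def)
      finally show ?thesis by (simp add: D_def mult.commute)
    qed
    have degD: "p - 1 \<le> D" by (simp add: D_def)
    \<comment> \<open>Single Taylor coefficients need not be rational; the hypothesis
      \<open>mom\<close> makes only their weighted sums integral, up to a power of
      \<open>a\<close>.\<close>
    define S where "S k = (\<Sum>g\<in>G. of_int (t g) * coeff (pcompose f [:g, 1:]) k)" for k
    have total: "(\<Sum>g\<in>G. of_int (t g) * hermite_sum f g) = (\<Sum>k\<le>D. fact k * S k)"
    proof -
      have "hermite_sum f g = (\<Sum>k\<le>D. fact k * coeff (pcompose f [:g, 1:]) k)" for g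
        unfolding hermite_sum_def using degf
        by (intro sum.mono_neutral_left) (auto simp: coeff_eq_0 degree_pcompose)
      then show ?thesis
        by (simp add: S_def sum_distrib_left mult_ac, subst sum.swap) simp
    qed
    have shift0: "pcompose f [:0, 1:] = f" using pcompose_idR[of f] by simp
    \<comment> \<open>At a nonzero exponent \<open>f\<close> vanishes to order \<open>p\<close>, so
      below \<open>k = p\<close> only the exponent 0 contributes.\<close>
    have Sred: "S k = of_int (t 0) * coeff f k" if "k < p" for k
    proof -
      have "coeff (pcompose f [:g, 1:]) k = 0" if "g \<in> G - {0}" for g
      proof (rule coeff_pcompose_shift_eq_0[OF _ \<open>k < p\<close>])
        show "[:- g, 1:] ^ p dvd f"
          unfolding f_eq using root[OF that] by (simp add: dvd_power_same)
      qed
      then show ?thesis unfolding S_def using fin G0(1)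
        by (subst sum.remove[of _ 0]) (auto simp: shift0)
    qed
    have f_low: "coeff f k = 0" if "k < p - 1" for k
      using that by (simp add: f_eq coeff_monom_mult)
    have f_mid: "coeff f (p - 1) = of_int (c0 ^ p)"
      by (simp add: f_eq coeff_monom_mult coeff_0_power coeff_map_poly c0_def)
    have S_int: "of_int a ^ D * S k \<in> \<int>" for k
    proof -
      have "of_int a ^ D * S k = (\<Sum>n\<le>degree f. coeff f n * of_nat (n choose k) * of_int a ^ (D - (n - k)) *
            (of_int a ^ (n - k) * (\<Sum>g\<in>G. of_int (t g) * g ^ (n - k))))" (is "_ = ?R")
      proof -
        have "of_int a ^ D * S k =
          (\<Sum>n\<le>degree f. of_int a ^ D * (coeff f n * of_nat (n choose k) * (\<Sum>g\<in>G. of_int (t g) * g ^ (n - k))))"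
          unfolding S_def coeff_pcompose_shift sum_distrib_left
          by (subst sum.swap) (simp add: mult_ac)
        also have "\<dots> = ?R"
        proof (rule sum.cong[OF refl])
          fix n assume "n \<in> {..degree f}"
          then have "D = (D - (n - k)) + (n - k)" using degf by simp
          then have "of_int a ^ D = (of_int a ^ (D - (n - k)) * of_int a ^ (n - k) :: complex)"
            by (metis power_add)
          then show "of_int a ^ D * (coeff f n * of_nat (n choose k) * (\<Sum>g\<in>G. of_int (t g) * g ^ (n - k)))
            = coeff f n * of_nat (n choose k) * of_int a ^ (D - (n - k)) *
            (of_int a ^ (n - k) * (\<Sum>g\<in>G. of_int (t g) * g ^ (n - k)))"
            by (simp add: mult_ac)
        qed
        finally show ?thesis .
      qed
      also have "\<dots> \<in> \<int>"
        by (intro Ints_sum Ints_mult mom) (auto simp: f_def coeff_map_poly intro: Ints_power)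
      finally show ?thesis .
    qed
    have "\<forall>k. \<exists>z. of_int a ^ D * S k = of_int z"
      using S_int by (auto simp: Ints_def)
    then obtain z where z: "\<And>k. of_int a ^ D * S k = of_int (z k)"
      by (auto simp: choice_iff)
    define w where "w = (\<Sum>k\<in>{p..D}. (fact k div fact p) * z k)"
    have fk: "fact k = (fact (p - 1) * int p) * (fact k div fact p)" if "k \<ge> p" for k
    proof -
      have "fact p = fact (p - 1) * int p" using p0 by (simp add: fact_reduce mult.commute)
      moreover have "(fact p :: int) dvd fact k" using that by (rule fact_dvd)
      ultimately show ?thesis using dvd_mult_div_cancel by metis
    qed
    \<comment> \<open>The term for \<open>k = p - 1\<close> escapes divisibility by
      \<open>p\<close>; every later one contains \<open>fact k\<close> and hence a factor
      \<open>p\<close> beyond \<open>fact (p - 1)\<close>.\<close>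
    define Z where "Z = a ^ D * t 0 * c0 ^ p + int p * w"
    have "of_int a ^ D * (\<Sum>g\<in>G. of_int (t g) * hermite_sum f g) = fact (p - 1) * of_int Z"
    proof -
      have "(\<Sum>k\<le>D. fact k * (of_int a ^ D * S k)) =
        (\<Sum>k<p-1. fact k * (of_int a ^ D * S k)) + (\<Sum>k=p-1..D. fact k * (of_int a ^ D * S k))"
        using degD by (subst sum.union_disjoint[symmetric]) (auto intro!: sum.cong)
      also have "(\<Sum>k<p-1. fact k * (of_int a ^ D * S k)) = 0"
        by (intro sum.neutral) (auto simp: Sred f_low)
      also have "(\<Sum>k=p-1..D. fact k * (of_int a ^ D * S k)) =
         fact (p - 1) * (of_int a ^ D * S (p - 1)) + (\<Sum>k=p..D. fact k * (of_int a ^ D * S k))"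
        using degD p0 by (subst sum.atLeast_Suc_atMost) auto
      also have "of_int a ^ D * S (p - 1) = of_int (a ^ D * t 0 * c0 ^ p)"
        using p0 Sred[of "p - 1"] f_mid by simp
      also have "(\<Sum>k=p..D. fact k * (of_int a ^ D * S k)) = of_int (fact (p - 1) * (int p * w))"
      proof -
        have "(\<Sum>k=p..D. fact k * (of_int a ^ D * S k)) = of_int (\<Sum>k=p..D. fact k * z k)"
          by (simp add: z)
        also have "(\<Sum>k=p..D. fact k * z k) = (\<Sum>k=p..D. fact (p - 1) * int p * (fact k div fact p) * z k)"
          by (intro sum.cong refl) (use fk in auto)
        also have "\<dots> = fact (p - 1) * (int p * w)"
          by (simp add: w_def sum_distrib_left mult_ac)
        finally show ?thesis .
      qed
      finally have "(\<Sum>k\<le>D. fact k * (of_int a ^ D * S k)) = fact (p - 1) * of_int Z"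
        by (simp add: Z_def algebra_simps)
      then show ?thesis
        unfolding total sum_distrib_left by (simp only: mult.left_commute)
    qed
    from arg_cong[OF this, of norm] have nrm: "of_int a ^ D * norm (\<Sum>g\<in>G. of_int (t g) * hermite_sum f g) = fact (p - 1) * \<bar>of_int Z\<bar>"
      using a by (simp add: norm_mult norm_power)
    have "\<not> int p dvd a ^ D * t 0 * c0 ^ p"
    proof
      assume "int p dvd a ^ D * t 0 * c0 ^ p"
      moreover have "prime (int p)" using p(1) by simp
      ultimately have "int p dvd a \<or> int p dvd t 0 \<or> int p dvd c0"
        using prime_dvd_power[of "int p"] by (simp only: prime_dvd_mult_iff) blast
      moreover have "\<not> int p dvd x" if "x \<noteq> 0" "int p > \<bar>x\<bar>" for x
        using that zdvd_not_zless[of "\<bar>x\<bar>" "int p"] by auto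
      ultimately show False using p a c0 G0(2) by auto
    qed
    then have "Z \<noteq> 0" unfolding Z_def by (metis add.commute dvd_0_right dvd_add_right_iff dvd_triv_left)
    then have "(1::real) \<le> \<bar>of_int Z\<bar>" by linarith
    then have "fact (p - 1) \<le> fact (p - 1) * \<bar>of_int Z :: real\<bar>" by simp
    also have "\<dots> = of_int a ^ D * norm (\<Sum>g\<in>G. of_int (t g) * hermite_sum f g)" by (simp add: nrm)
    \<comment> \<open>What is subtracted is \<open>hermite_sum f 0\<close> times the exponential sum
      assumed to be 0.\<close>
    also have "(\<Sum>g\<in>G. of_int (t g) * hermite_sum f g) =
        (\<Sum>g\<in>G. of_int (t g) * (hermite_sum f g - exp g * hermite_sum f 0))"
    proof -
      have "(\<Sum>g\<in>G. of_int (t g) * (exp g * hermite_sum f 0)) = 0"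
        using eq0 by (simp add: sum_distrib_right[symmetric] mult.assoc[symmetric])
      then show ?thesis by (simp add: right_diff_distrib sum_subtractf)
    qed
    also have "norm \<dots> \<le> (\<Sum>g\<in>G. \<bar>of_int (t g)\<bar> * exp (norm g) * abs_poly_eval f r)"
    proof (rule sum_norm_le)
      fix g assume "g \<in> G"
      then show "norm (of_int (t g) * (hermite_sum f g - exp g * hermite_sum f 0))
        \<le> \<bar>of_int (t g)\<bar> * exp (norm g) * abs_poly_eval f r"
        using norm_hermite_sum_diff[OF r(2), of g f] by (simp add: norm_mult mult.assoc mult_left_mono)
    qed
    also have "\<dots> = W * abs_poly_eval f r" by (simp add: W_def sum_distrib_right)
    also have "abs_poly_eval f r \<le> (r * B) ^ p"
    proof -
      have "abs_poly_eval f r \<le> abs_poly_eval (monom 1 (p - 1)) r * abs_poly_eval (?h \<Theta> ^ p) r"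
        unfolding f_eq using r by (intro abs_poly_eval_mult) auto
      also have "abs_poly_eval (monom 1 (p - 1)) r = r ^ (p - 1)"
        by (simp add: abs_poly_eval_def degree_monom_eq coeff_monom if_distrib[of norm] if_distrib[of "\<lambda>x. x * _"] cong: if_cong)
      also have "r ^ (p - 1) * abs_poly_eval (?h \<Theta> ^ p) r \<le> r ^ p * B ^ p"
        using r abs_poly_eval_power[of r "?h \<Theta>" p]
        by (intro mult_mono) (auto simp: B_def abs_poly_eval_nonneg intro: power_increasing)
      finally show ?thesis by (simp add: power_mult_distrib)
    qed
    also have "of_int a ^ D * (W * (r * B) ^ p) \<le> of_int a ^ (Suc m * p) * (W * (r * B) ^ p)"
      using a W0 r B0 by (intro mult_right_mono power_increasing) (auto simp: D_def)
    also have "\<dots> = W * L ^ p" unfolding L_def power_mult power_mult_distrib by (simp only: mult_ac)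
    finally show ?thesis using a W0 by (simp add: mult_left_mono)
  qed
  have "(\<lambda>n. (W * L + 1) * (L ^ n / fact n)) \<longlonglongrightarrow> (W * L + 1) * 0"
    using summable_LIMSEQ_zero[OF summable_exp[of L]] by (intro tendsto_mult_left) (simp add: field_simps)
  then have "eventually (\<lambda>n. (W * L + 1) * (L ^ n / fact n) < 1) sequentially"
    by (rule order_tendstoD) auto
  then obtain N where N: "\<And>n. n \<ge> N \<Longrightarrow> (W * L + 1) * (L ^ n / fact n) < 1"
    by (auto simp: eventually_sequentially)
  obtain p :: nat where p: "prime p" "p > N + nat \<bar>a\<bar> + nat \<bar>t 0\<bar> + nat \<bar>c0\<bar> + 1"
    using bigger_prime by blast
  then have "fact (p - 1) \<le> W * L ^ p" by (intro key) auto
  also have "L ^ p = L * L ^ (p - 1)" using p(2) by (metis Suc_diff_1 add_gr_0 gr_implies_not0 not_gr0 power_Suc)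
  also have "W * (L * L ^ (p - 1)) \<le> (W * L + 1) * L ^ (p - 1)"
    using L0 by (simp add: algebra_simps)
  also have "\<dots> < fact (p - 1)" using N[of "p - 1"] p(2) by (simp add: field_simps)
  finally show False by simp
qed

section \<open>Formal power series with integral moments\<close>

definition hurwitz_int :: "complex fps set" where
  "hurwitz_int = {\<phi>. \<forall>n. fact n * fps_nth \<phi> n \<in> \<int>}"

text \<open>These are the Hurwitz series over the integers: multiplication is binomial convolution
  of the scaled coefficients, so binomial coefficients absorb the factorials.\<close>

lemma hurwitz_int_subring: "is_subring hurwitz_int"
  unfolding is_subring_def
proof (intro conjI ballI)
  show "1 \<in> hurwitz_int" by (auto simp: hurwitz_int_def)
  fix \<phi> \<psi> assume *: "\<phi> \<in> hurwitz_int" "\<psi> \<in> hurwitz_int"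
  then show "\<phi> - \<psi> \<in> hurwitz_int" by (auto simp: hurwitz_int_def right_diff_distrib)
  show "\<phi> * \<psi> \<in> hurwitz_int" unfolding hurwitz_int_def
  proof safe
    fix n
    have "fact n * fps_nth (\<phi> * \<psi>) n = (\<Sum>i=0..n. of_nat (n choose i) *
        ((fact i * fps_nth \<phi> i) * (fact (n - i) * fps_nth \<psi> (n - i))))"
      unfolding fps_mult_nth sum_distrib_left
      by (intro sum.cong refl) (simp add: binomial_fact)
    also have "\<dots> \<in> \<int>"
      using * by (intro Ints_sum Ints_mult[OF _ Ints_mult]) (simp_all add: hurwitz_int_def)
    finally show "fact n * fps_nth (\<phi> * \<psi>) n \<in> \<int>" .
  qed
qed

text \<open>Products commute with rescaling of the variable by \<open>a\<close>. The bound
  \<open>n\<close> is there because the factors to which this is applied are truncated.\<close>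

lemma fps_nth_prod_cong:
  fixes f g :: "'i \<Rightarrow> complex fps"
  assumes "\<And>i k. i \<in> I \<Longrightarrow> k \<le> n \<Longrightarrow> fps_nth (f i) k = a ^ k * fps_nth (g i) k"
  shows "k \<le> n \<Longrightarrow> fps_nth (\<Prod>i\<in>I. f i) k = a ^ k * fps_nth (\<Prod>i\<in>I. g i) k"
  using assms
proof (induction I arbitrary: k rule: infinite_finite_induct)
  case (insert x I)
  have "fps_nth (\<Prod>i\<in>insert x I. f i) k =
      (\<Sum>i=0..k. a ^ i * fps_nth (g x) i * (a ^ (k - i) * fps_nth (\<Prod>i\<in>I. g i) (k - i)))"
    using insert by (simp add: fps_mult_nth)
  also have "\<dots> = (\<Sum>i=0..k. a ^ k * (fps_nth (g x) i * fps_nth (\<Prod>i\<in>I. g i) (k - i)))"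
  proof (intro sum.cong refl)
    fix i assume "i \<in> {0..k}"
    then have "a ^ k = a ^ i * a ^ (k - i)" by (simp flip: power_add)
    then show "a ^ i * fps_nth (g x) i * (a ^ (k - i) * fps_nth (\<Prod>i\<in>I. g i) (k - i)) =
      a ^ k * (fps_nth (g x) i * fps_nth (\<Prod>i\<in>I. g i) (k - i))" by (simp add: mult_ac)
  qed
  also have "\<dots> = a ^ k * fps_nth (\<Prod>i\<in>insert x I. g i) k"
    using insert by (simp add: fps_mult_nth sum_distrib_left)
  finally show ?case .
qed auto

text \<open>The expansion of F(exp (b X)) in powers of X. Up to n!, its coefficients are the power
  moments of the exponents \<open>k * b\<close> weighted by the coefficients of
  \<open>F\<close>.\<close>

definition exp_poly_fps :: "int poly \<Rightarrow> complex \<Rightarrow> complex fps" where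
  "exp_poly_fps F b = (\<Sum>k\<le>degree F. of_int (coeff F k) * fps_exp (of_nat k * b))"

lemma fps_nth_exp_poly_fps:
  "fps_nth (exp_poly_fps F b) n = b ^ n * fps_nth (exp_poly_fps F 1) n"
  unfolding exp_poly_fps_def fps_sum_nth sum_distrib_left
  by (intro sum.cong refl) (simp add: power_mult_distrib fps_of_int[symmetric])

lemma fact_fps_nth_exp_poly_fps: "fact n * fps_nth (exp_poly_fps F 1) n = (\<Sum>k\<le>degree F. of_int (coeff F k) * of_nat k ^ n)"
  by (simp add: exp_poly_fps_def fps_sum_nth sum_distrib_left fps_of_int[symmetric])

text \<open>If all power moments vanish, so does the weighted sum of the values of any polynomial at
  0, ..., \<open>degree F\<close>; one that vanishes at all of these but the last isolates the
  leading coefficient.\<close>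

lemma exp_poly_fps_nonzero:
  assumes "F \<noteq> 0" "b \<noteq> 0"
  shows "exp_poly_fps F b \<noteq> 0"
proof
  assume 0: "exp_poly_fps F b = 0"
  have mom: "(\<Sum>k\<le>degree F. of_int (coeff F k) * of_nat k ^ n) = (0 :: complex)" for n
    using assms(2) fps_nth_exp_poly_fps[of F b n] fact_fps_nth_exp_poly_fps[of n F] by (simp add: 0)
  define q :: "complex poly" where "q = (\<Prod>j<degree F. [:- of_nat j, 1:])"
  have "0 = (\<Sum>n\<le>degree q. coeff q n * (\<Sum>k\<le>degree F. of_int (coeff F k) * of_nat k ^ n))"
    by (simp add: mom)
  also have "\<dots> = (\<Sum>k\<le>degree F. of_int (coeff F k) * poly q (of_nat k))"
    by (simp add: poly_altdef sum_distrib_left mult_ac) (rule sum.swap)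
  also have "\<dots> = of_int (coeff F (degree F)) * poly q (of_nat (degree F))"
  proof -
    have "poly q (of_nat k) = 0" if "k < degree F" for k
      using that by (auto simp: q_def poly_prod)
    then show ?thesis by (subst sum.remove[of _ "degree F"]) auto
  qed
  finally have "poly q (of_nat (degree F)) = 0" using assms(1) by simp
  then show False by (auto simp: q_def poly_prod)
qed

text \<open>After replacing X by a X, the factors agree up to order \<open>n\<close> with values of
  one polynomial \<open>h\<close> at the algebraic integers \<open>of_int a * b i\<close>, so the
  norm argument applies over the Hurwitz series.\<close>

lemma prod_exp_poly_fps_hurwitz_int:
  fixes b :: "nat \<Rightarrow> complex" and a :: int
  assumes a: "a > 0" and inj: "inj_on b {..<d}"
    and m: "lead_coeff m = 1" "degree m = d" "\<And>i. coeff m i \<in> \<int>"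
      "\<And>i. i < d \<Longrightarrow> poly m (of_int a * b i) = 0"
  shows "of_int a ^ n * (fact n * fps_nth (\<Prod>i<d. exp_poly_fps F (b i)) n) \<in> \<int>"
proof -
  define e where "e = fps_nth (exp_poly_fps F 1)"
  \<comment> \<open>The power series in the conjugate is cut at \<open>n\<close> to obtain a
    polynomial; later terms do not affect the coefficient in question.\<close>
  define h where "h = (\<Sum>k\<le>n. monom (fps_const (e k) * fps_X ^ k) k)"
  have ch: "coeff h k = (if k \<le> n then fps_const (e k) * fps_X ^ k else 0)" for k
    by (auto simp: h_def coeff_sum)
  define c where "c i = fps_const (of_int a * b i)" for i
  define M where "M = map_poly fps_const m"
  have pM: "poly M (fps_const x) = fps_const (poly m x)" for x
    unfolding M_def by (induction m) (auto simp: map_poly_pCons)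
  have "(\<Prod>i<d. poly h (c i)) \<in> hurwitz_int"
  proof (rule prod_poly_roots_mem[OF hurwitz_int_subring])
    show "inj_on c {..<d}" using inj a by (auto simp: inj_on_def c_def)
    show "degree M = d" unfolding M_def using m(2) by (subst degree_map_poly) auto
    then show "lead_coeff M = 1" using m(1,2) by (simp add: M_def coeff_map_poly)
    show "coeff M i \<in> hurwitz_int" for i
      using m(3) by (auto simp: M_def coeff_map_poly hurwitz_int_def)
    show "poly M (c i) = 0" if "i < d" for i using m(4)[OF that] by (simp add: c_def pM)
    show "coeff h k \<in> hurwitz_int" for k
    proof (cases "k \<le> n")
      case True
      have "fact k * e k \<in> \<int>" unfolding e_def fact_fps_nth_exp_poly_fps
        by (intro Ints_sum Ints_mult Ints_power) auto
      then show ?thesis using True by (auto simp: ch hurwitz_int_def fps_X_power_iff)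
    qed (auto simp: ch hurwitz_int_def)
  qed
  moreover have "fps_nth (\<Prod>i<d. poly h (c i)) n = of_int a ^ n * fps_nth (\<Prod>i<d. exp_poly_fps F (b i)) n"
  proof (rule fps_nth_prod_cong[OF _ order_refl])
    fix i k assume k: "k \<le> n"
    have "poly h (c i) = (\<Sum>j\<le>n. fps_const (e j * (of_int a * b i) ^ j) * fps_X ^ j)"
      by (simp add: h_def poly_sum poly_monom c_def fps_const_power[symmetric] fps_const_mult[symmetric] mult_ac
          del: fps_const_power fps_const_mult)
    then have "fps_nth (poly h (c i)) k = e k * (of_int a * b i) ^ k"
      using k by (simp add: fps_sum_nth fps_X_power_iff if_distrib[of "\<lambda>x. _ * x"] cong: if_cong)
    then show "fps_nth (poly h (c i)) k = of_int a ^ k * fps_nth (exp_poly_fps F (b i)) k"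
      using fps_nth_exp_poly_fps[of F "b i" k] by (simp add: e_def power_mult_distrib mult_ac)
  qed
  ultimately have "fact n * (of_int a ^ n * fps_nth (\<Prod>i<d. exp_poly_fps F (b i)) n) \<in> \<int>"
    unfolding hurwitz_int_def by (metis (mono_tags) mem_Collect_eq)
  then show ?thesis by (simp only: mult.left_commute)
qed

lemma keys_prod_subset:
  fixes F :: "'i \<Rightarrow> ('a::comm_monoid_add \<Rightarrow>\<^sub>0 'b::comm_ring_1)"
  assumes "0 \<in> A" "\<And>x y. x \<in> A \<Longrightarrow> y \<in> A \<Longrightarrow> x + y \<in> A"
    and "\<And>i. i \<in> I \<Longrightarrow> Poly_Mapping.keys (F i) \<subseteq> A"
  shows "Poly_Mapping.keys (\<Prod>i\<in>I. F i) \<subseteq> A"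
  using assms(3)
proof (induction I rule: infinite_finite_induct)
  case (insert x I)
  have "Poly_Mapping.keys (F x) \<subseteq> A" "Poly_Mapping.keys (\<Prod>i\<in>I. F i) \<subseteq> A"
    using insert by auto
  then have "Poly_Mapping.keys (F x * (\<Prod>i\<in>I. F i)) \<subseteq> A"
    using keys_mult[of "F x" "\<Prod>i\<in>I. F i"] assms(2) by blast
  then show ?case using insert by simp
qed (use assms(1) in auto)

lemma lookup_times_single:
  fixes P :: "'a::ab_group_add \<Rightarrow>\<^sub>0 'b::comm_ring_1"
  shows "Poly_Mapping.lookup (P * Poly_Mapping.single w c) v = Poly_Mapping.lookup P (v - w) * c"
  by (induction P rule: poly_mapping_single_induct)
     (auto simp: distrib_right lookup_add mult_single lookup_single when_def eq_diff_eq)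

theorem hermite_lindemann:
  fixes \<alpha> :: complex
  assumes alg: "algebraic \<alpha>" and nz: "\<alpha> \<noteq> 0"
  shows "\<not> algebraic (exp \<alpha>)"
proof
  assume "algebraic (exp \<alpha>)"
  then obtain F :: "int poly" where F: "F \<noteq> 0" "poly (map_poly of_int F) (exp \<alpha>) = 0"
    by (rule algebraicE')
  obtain b :: "nat \<Rightarrow> complex" and d :: nat and a :: int and m where
    a: "a > 0" and inj: "inj_on b {..<d}" and ab: "\<alpha> \<in> b ` {..<d}" and b0: "\<And>i. i < d \<Longrightarrow> b i \<noteq> 0"
    and m: "lead_coeff m = 1" "degree m = d" "\<And>i. coeff m i \<in> \<int>"
      "\<And>i. i < d \<Longrightarrow> poly m (of_int a * b i) = 0"
    using algebraic_conjugates[OF alg nz] by metis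
  have algb: "algebraic (b i)" if "i < d" for i
  proof -
    have "m \<noteq> 0" using m(1) by auto
    then have ab: "algebraic (of_int a * b i)" using m(3) m(4)[OF that] by (intro algebraicI[of m]) auto
    have "algebraic (inverse (of_int a) * (of_int a * b i))"
      by (intro algebraic_mult[OF _ ab] algebraic_inverse) (auto intro: rat_imp_algebraic)
    moreover have "inverse (of_int a) * (of_int a * b i) = b i" using a by simp
    ultimately show ?thesis by (simp only:)
  qed
  define K where "K i = (\<Sum>k\<le>degree F. Poly_Mapping.single (of_nat k * b i) (coeff F k))" for i
  define R where "R = (\<Prod>i<d. K i)"
  define R' where "R' = (\<Sum>g\<in>Poly_Mapping.keys R. Poly_Mapping.single (- g) (Poly_Mapping.lookup R g))"
  define T where "T = R * R'"
  \<comment> \<open>Two evaluations of the same sums: into power series, to read off moments and to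
    show \<open>R\<close> nonzero, and into the complex numbers, where the factor belonging to
    \<alpha> vanishes.\<close>
  interpret f: pm_eval_hom "of_int :: int \<Rightarrow> complex fps" fps_exp
    by unfold_locales (auto simp: fps_exp_add_mult)
  interpret c: pm_eval_hom "of_int :: int \<Rightarrow> complex" exp
    by unfold_locales (auto simp: exp_add)
  define \<Phi> where "\<Phi> = (\<Prod>i<d. exp_poly_fps F (b i))"
  have fR: "pm_eval of_int fps_exp R = \<Phi>"
    by (simp add: R_def K_def f.eval_prod f.eval_sum \<Phi>_def exp_poly_fps_def)
  have "\<Phi> \<noteq> 0" unfolding \<Phi>_def using exp_poly_fps_nonzero[OF F(1)] b0 by auto
  then have R0: "R \<noteq> 0" using fR by auto
  have fR': "fps_nth (pm_eval of_int fps_exp R') n = (- 1) ^ n * fps_nth \<Phi> n" for n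
    unfolding fR[symmetric] R'_def f.eval_sum f.eval_single pm_eval_def[of _ _ R]
      fps_sum_nth sum_distrib_left
  proof (rule sum.cong[OF refl])
    fix g :: complex
    have "(- g) ^ n = (- 1) ^ n * g ^ n" by (metis mult_minus1 power_mult_distrib)
    then show "fps_nth (of_int (Poly_Mapping.lookup R g) * fps_exp (- g)) n =
      (- 1) ^ n * fps_nth (of_int (Poly_Mapping.lookup R g) * fps_exp g) n"
      by (simp add: fps_of_int[symmetric])
  qed
  have T0: "Poly_Mapping.lookup T 0 > 0"
  proof -
    have "Poly_Mapping.lookup T 0 = (\<Sum>g\<in>Poly_Mapping.keys R. (Poly_Mapping.lookup R g)\<^sup>2)"
      by (simp add: T_def R'_def sum_distrib_left lookup_sum lookup_times_single power2_eq_square)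
    also have "\<dots> > 0"
      using R0 by (intro sum_pos) (auto simp: in_keys_iff keys_eq_empty)
    finally show ?thesis .
  qed
  have algT: "algebraic g" if "g \<in> Poly_Mapping.keys T" for g
  proof -
    have KA: "Poly_Mapping.keys (K i) \<subseteq> {g. algebraic g}" if "i < d" for i
    proof -
      have "Poly_Mapping.keys (K i) \<subseteq> (\<Union>k\<le>degree F. {of_nat k * b i})"
        unfolding K_def by (rule order_trans[OF keys_sum]) (auto split: if_splits)
      moreover have "algebraic (of_nat k * b i)" for k
        by (rule algebraic_mult[OF rat_imp_algebraic algb[OF that]]) auto
      ultimately show ?thesis by auto
    qed
    have RA: "Poly_Mapping.keys R \<subseteq> {g. algebraic g}"
      unfolding R_def by (rule keys_prod_subset) (use KA in \<open>auto intro: algebraic_add\<close>)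
    moreover have "Poly_Mapping.keys R' \<subseteq> (\<Union>g\<in>Poly_Mapping.keys R. {- g})"
      unfolding R'_def by (rule order_trans[OF keys_sum]) (auto split: if_splits)
    ultimately have "Poly_Mapping.keys R' \<subseteq> {g. algebraic g}" by auto
    then show ?thesis
      using RA keys_mult[of R R'] that algebraic_add unfolding T_def by blast
  qed
  \<comment> \<open>The n-th moment of \<open>T\<close> is n! times the n-th coefficient of
    \<Phi>(X) \<Phi>(-X), hence a signed binomial convolution of moments of
    \<open>R\<close>.\<close>
  have momT: "of_int a ^ n * (\<Sum>g\<in>Poly_Mapping.keys T. of_int (Poly_Mapping.lookup T g) * g ^ n) \<in> \<int>" for n
  proof -
    have "(\<Sum>g\<in>Poly_Mapping.keys T. of_int (Poly_Mapping.lookup T g) * g ^ n) =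
      fact n * fps_nth (pm_eval of_int fps_exp T) n"
      by (simp add: pm_eval_def fps_sum_nth sum_distrib_left fps_of_int[symmetric])
    also have "\<dots> = fact n * fps_nth (\<Phi> * pm_eval of_int fps_exp R') n"
      by (simp add: T_def f.eval_mult fR)
    also have "of_int a ^ n * \<dots> = (\<Sum>i=0..n. of_nat (n choose i) * (- 1) ^ (n - i) *
        ((of_int a ^ i * (fact i * fps_nth \<Phi> i)) * (of_int a ^ (n - i) * (fact (n - i) * fps_nth \<Phi> (n - i)))))"
      unfolding fps_mult_nth sum_distrib_left fR'
    proof (intro sum.cong refl)
      fix i assume i: "i \<in> {0..n}"
      then have "of_int a ^ n = (of_int a ^ i * of_int a ^ (n - i) :: complex)"
        by (simp flip: power_add)
      moreover have "fact n = (of_nat (n choose i) * fact i * fact (n - i) :: complex)"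
        using i by (simp add: binomial_fact)
      ultimately show "of_int a ^ n * (fact n * (fps_nth \<Phi> i * ((- 1) ^ (n - i) * fps_nth \<Phi> (n - i)))) =
        of_nat (n choose i) * (- 1) ^ (n - i) *
        ((of_int a ^ i * (fact i * fps_nth \<Phi> i)) * (of_int a ^ (n - i) * (fact (n - i) * fps_nth \<Phi> (n - i))))"
        by (simp add: mult_ac)
    qed
    also have "\<dots> \<in> \<int>"
    proof -
      have P: "of_int a ^ j * (fact j * fps_nth \<Phi> j) \<in> \<int>" for j
        unfolding \<Phi>_def by (rule prod_exp_poly_fps_hurwitz_int[OF a inj m])
      have Q: "of_nat (n choose i) * (- 1) ^ (n - i) \<in> (\<int> :: complex set)" for i
        by (intro Ints_mult Ints_power) auto
      show ?thesis by (rule Ints_sum, rule Ints_mult[OF Q], rule Ints_mult[OF P P])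
    qed
    finally show ?thesis .
  qed
  have "(\<Sum>g\<in>Poly_Mapping.keys T. of_int (Poly_Mapping.lookup T g) * exp g) \<noteq> 0"
    using T0 by (intro exp_sum_nonzero[OF _ _ _ algT a momT]) (auto simp: in_keys_iff)
  moreover have "pm_eval of_int exp T = 0"
  proof -
    obtain i where i: "i < d" "b i = \<alpha>" using ab by auto
    have "pm_eval of_int exp (K i) = (\<Sum>k\<le>degree F. of_int (coeff F k) * exp \<alpha> ^ k)"
      using i by (simp add: K_def c.eval_sum exp_of_nat_mult)
    also have "\<dots> = 0" using F(2) by (simp add: poly_altdef degree_map_poly coeff_map_poly)
    finally have "pm_eval of_int exp R = 0"
      unfolding R_def c.eval_prod using i by (intro prod_zero) auto
    then show ?thesis by (simp add: T_def c.eval_mult)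
  qed
  ultimately show False by (simp add: pm_eval_def)
qed

subsection \<open>Common zeros of bivariate polynomials with algebraic coefficients\<close>

definition algebraic_poly :: "complex poly \<Rightarrow> bool" where
  "algebraic_poly p \<longleftrightarrow> (\<forall>i. algebraic (coeff p i))"

definition algebraic_bipoly :: "complex poly poly \<Rightarrow> bool" where
  "algebraic_bipoly F \<longleftrightarrow> (\<forall>k. algebraic_poly (coeff F k))"

lemma algebraic_1: "algebraic (1 :: complex)" and algebraic_of_nat: "algebraic (of_nat n :: complex)"
  by (auto intro: rat_imp_algebraic)

lemma algebraic_poly_add: "algebraic_poly p \<Longrightarrow> algebraic_poly q \<Longrightarrow> algebraic_poly (p + q)"
  and algebraic_poly_diff: "algebraic_poly p \<Longrightarrow> algebraic_poly q \<Longrightarrow> algebraic_poly (p - q)"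
  by (auto simp: algebraic_poly_def algebraic_add algebraic_diff)

lemma algebraic_poly_0: "algebraic_poly 0" and algebraic_poly_1: "algebraic_poly 1"
  by (auto simp: algebraic_poly_def coeff_pCons one_pCons algebraic_1 split: nat.splits)

lemma algebraic_poly_monom: "algebraic c \<Longrightarrow> algebraic_poly (monom c n)"
  by (auto simp: algebraic_poly_def)

lemma algebraic_poly_mult: "algebraic_poly p \<Longrightarrow> algebraic_poly q \<Longrightarrow> algebraic_poly (p * q)"
  unfolding algebraic_poly_def coeff_mult by (auto intro!: algebraic_sum algebraic_mult)

lemma algebraic_poly_sum: "(\<And>i. i \<in> I \<Longrightarrow> algebraic_poly (f i)) \<Longrightarrow> algebraic_poly (\<Sum>i\<in>I. f i)"
  by (induction I rule: infinite_finite_induct) (auto intro: algebraic_poly_add algebraic_poly_0)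

lemma algebraic_poly_prod: "(\<And>i. i \<in> I \<Longrightarrow> algebraic_poly (f i)) \<Longrightarrow> algebraic_poly (\<Prod>i\<in>I. f i)"
  by (induction I rule: infinite_finite_induct) (auto intro: algebraic_poly_mult algebraic_poly_1)

lemma algebraic_poly_pderiv: "algebraic_poly p \<Longrightarrow> algebraic_poly (pderiv p)"
  unfolding algebraic_poly_def coeff_pderiv by (auto intro!: algebraic_mult algebraic_of_nat simp del: of_nat_Suc)

lemma algebraic_poly_root:
  "algebraic_poly p \<Longrightarrow> p \<noteq> 0 \<Longrightarrow> poly p x = 0 \<Longrightarrow> algebraic x"
  unfolding algebraic_poly_def using algebraic_root_algebraic_poly by blast

lemma algebraic_power: "algebraic x \<Longrightarrow> algebraic (x ^ n :: complex)"
  by (induction n) (auto intro: algebraic_mult algebraic_1)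

lemma algebraic_poly_eval: "algebraic_poly p \<Longrightarrow> algebraic x \<Longrightarrow> algebraic (poly p x)"
  unfolding poly_altdef algebraic_poly_def
  by (intro algebraic_sum algebraic_mult algebraic_power) auto

text \<open>The zeros of a factor are zeros of \<open>f\<close>, hence algebraic, and they determine
  the monic multiple of the factor.\<close>

lemma algebraic_poly_factor:
  assumes "algebraic_poly f" "f \<noteq> 0" "a dvd f"
  obtains c where "c \<noteq> 0" "algebraic_poly (Polynomial.smult c a)"
proof -
  have a0: "a \<noteq> 0" using assms by auto
  obtain rt where rt: "Polynomial.smult (lead_coeff a) (\<Prod>i<degree a. [:- rt i, 1:]) = a"
    using complex_poly_decompose'[of a] by blast
  have "algebraic (rt i)" if "i < degree a" for i
  proof -
    have "poly a (rt i) = 0"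
      by (subst rt[symmetric]) (use that in \<open>auto simp: poly_prod\<close>)
    then have "poly f (rt i) = 0" using assms(3) by auto
    then show ?thesis using assms algebraic_poly_root by blast
  qed
  then have "algebraic_poly (\<Prod>i<degree a. [:- rt i, 1:])"
    by (intro algebraic_poly_prod)
       (auto simp: algebraic_poly_def coeff_pCons algebraic_1 split: nat.splits)
  moreover have "Polynomial.smult (inverse (lead_coeff a)) a = (\<Prod>i<degree a. [:- rt i, 1:])"
    using a0 by (subst (2) rt[symmetric]) simp
  ultimately show ?thesis using that[of "inverse (lead_coeff a)"] a0 by auto
qed

text \<open>Division of exponents by \<open>N\<close> with remainder: terms with
  \<open>k < j\<close> stop short of, and terms with \<open>k > j\<close> begin beyond, the exponent
  \<open>i + N * j\<close>.\<close>

lemma coeff_kronecker: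
  fixes F :: "'a::comm_ring_1 poly poly"
  assumes "\<And>k. degree (coeff F k) < N" "i < N"
  shows "coeff (poly F (monom 1 N)) (i + N * j) = coeff (coeff F j) i"
proof -
  have "coeff (poly F (monom 1 N)) (i + N * j) =
      (\<Sum>k\<le>degree F. if N * k \<le> i + N * j then coeff (coeff F k) (i + N * j - N * k) else 0)"
    by (simp add: poly_altdef monom_power coeff_sum mult.commute[of _ "monom _ _"] coeff_monom_mult,
        intro sum.cong) auto
  also have "\<dots> = (\<Sum>k\<le>degree F. if k = j then coeff (coeff F j) i else 0)"
  proof (rule sum.cong[OF refl])
    fix k
    consider "k = j" | "k < j" | "k > j" by linarith
    then show "(if N * k \<le> i + N * j then coeff (coeff F k) (i + N * j - N * k) else 0) =
        (if k = j then coeff (coeff F j) i else 0)"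
    proof cases
      case 2
      then have "N * Suc k \<le> N * j" by (intro mult_le_mono2) auto
      then have "N \<le> i + N * j - N * k" by simp
      then show ?thesis using 2 assms(1)[of k] by (auto simp: coeff_eq_0)
    next
      case 3
      then have "N * Suc j \<le> N * k" by (intro mult_le_mono2) auto
      then have "i + N * j < N * k" using assms(2) by simp
      then show ?thesis using 3 by auto
    qed simp
  qed
  also have "\<dots> = coeff (coeff F j) i" by (auto simp: coeff_eq_0)
  finally show ?thesis .
qed

text \<open>
  The substitution \<open>y \<mapsto> x\<^bsup>N\<^esup>\<close> turns factors of \<open>F\<close> into factors of a polynomial in one variable and,
  for large \<open>N\<close>, does not mix coefficients.
\<close>

lemma algebraic_bipoly_factor:
  assumes F: "algebraic_bipoly F" "F \<noteq> 0" and A: "A dvd F"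
  obtains c where "c \<noteq> 0" "algebraic_bipoly (Polynomial.smult [:c:] A)"
proof -
  \<comment> \<open>A crude bound exceeding all x-degrees in \<open>F\<close> and in
    \<open>A\<close>: for \<open>F\<close> it keeps the image nonzero, for \<open>A\<close> it lets
    coefficients be read back.\<close>
  define N where "N = Suc ((\<Sum>k\<le>degree F. degree (coeff F k)) + (\<Sum>k\<le>degree A. degree (coeff A k)))"
  have deg: "degree (coeff G k) \<le> (\<Sum>k\<le>degree G. degree (coeff G k))" for G :: "complex poly poly" and k
  proof (cases "k \<le> degree G")
    case True
    then show ?thesis by (intro member_le_sum) auto
  qed (simp add: coeff_eq_0)
  have N: "degree (coeff F k) < N" "degree (coeff A k) < N" for k
    using deg[of F k] deg[of A k] by (auto simp: N_def)
  let ?f = "poly F (monom 1 N)" and ?a = "poly A (monom 1 N)"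
  have "?a dvd ?f" using A by (auto elim!: dvdE)
  moreover have "algebraic_poly ?f"
    unfolding poly_altdef monom_power using F(1)
    by (intro algebraic_poly_sum algebraic_poly_mult algebraic_poly_monom)
       (auto simp: algebraic_bipoly_def algebraic_1)
  moreover have "?f \<noteq> 0"
  proof
    assume "?f = 0"
    then have "coeff (coeff F j) i = 0" for i j
      using coeff_kronecker[OF N(1), of i j] N(1)[of j] by (cases "i < N") (auto simp: coeff_eq_0)
    then show False using F(2) by (auto simp: poly_eq_iff)
  qed
  ultimately obtain c where c: "c \<noteq> 0" "algebraic_poly (Polynomial.smult c ?a)"
    using algebraic_poly_factor by blast
  have "algebraic (c * coeff (coeff A j) i)" for i j
  proof (cases "i < N")
    case True
    then show ?thesis
      using c(2) coeff_kronecker[OF N(2), of i j] unfolding algebraic_poly_def by (metis coeff_smult)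
  next
    case False
    then show ?thesis using N(2)[of j] by (auto simp: coeff_eq_0)
  qed
  then show ?thesis using that[OF c(1)] by (auto simp: algebraic_bipoly_def algebraic_poly_def)
qed

section \<open>Zeros of bivariate polynomials\<close>

definition bipoly_eval :: "complex poly poly \<Rightarrow> complex \<Rightarrow> complex \<Rightarrow> complex" where
  "bipoly_eval F x y = poly (poly F [:y:]) x"

lemma bipoly_eval_simps [simp]:
  "bipoly_eval 0 x y = 0" "bipoly_eval 1 x y = 1"
  "bipoly_eval (pCons a F) x y = poly a x + y * bipoly_eval F x y"
  "bipoly_eval (F + G) x y = bipoly_eval F x y + bipoly_eval G x y"
  "bipoly_eval (F - G) x y = bipoly_eval F x y - bipoly_eval G x y"
  "bipoly_eval (F * G) x y = bipoly_eval F x y * bipoly_eval G x y"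
  "bipoly_eval (F ^ n) x y = bipoly_eval F x y ^ n"
  "bipoly_eval (Polynomial.smult a F) x y = poly a x * bipoly_eval F x y"
  "bipoly_eval (monom a n) x y = poly a x * y ^ n"
  by (simp_all add: bipoly_eval_def poly_monom poly_power)

lemma bipoly_eval_swap: "poly (map_poly (\<lambda>p. poly p x) F) y = bipoly_eval F x y"
  by (induction F) (auto simp: map_poly_pCons)

lemma prime_elem_x_minus: "prime_elem [:[:- x, 1:]:]" for x :: complex
  by (intro lift_prime_elem_poly prime_elem_linear_field_poly) auto

lemma x_minus_dvd_iff: "[:[:- x, 1:]:] dvd F \<longleftrightarrow> (\<forall>k. poly (coeff F k) x = 0)" for x :: complex
  by (simp add: const_poly_dvd_iff poly_eq_0_iff_dvd)

lemma prime_divisor_vanishing: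
  assumes "F \<noteq> 0" "bipoly_eval F x y = 0"
  obtains \<pi> where "prime_elem \<pi>" "\<pi> dvd F" "bipoly_eval \<pi> x y = 0"
  using assms
proof (induction F arbitrary: thesis rule: prime_divisors_induct)
  case (unit F)
  then obtain G where "1 = F * G" by (auto elim!: dvdE)
  then have "1 = bipoly_eval F x y * bipoly_eval G x y" by (metis bipoly_eval_simps(2,6))
  then show ?case using unit by simp
next
  case (factor \<pi> F)
  show ?case
  proof (cases "bipoly_eval \<pi> x y = 0")
    case True
    then show ?thesis using factor.prems(1)[of \<pi>] factor.hyps by auto
  next
    case False
    then have "bipoly_eval F x y = 0" "F \<noteq> 0" using factor.prems by auto
    then show ?thesis using factor.IH factor.prems(1) by (metis dvd_mult)
  qed
qed auto

text \<open>
  If \<open>x\<^sub>0\<close> were transcendental, a polynomial \<open>G\<close> of least degree in \<open>y\<close> vanishing at \<open>(x\<^sub>0, y\<^sub>0)\<close> would divide,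
  up to factors in \<open>x\<close>, both \<open>A\<close> and \<open>B\<close>.
\<close>

lemma common_zero_algebraic:
  assumes alg: "algebraic_bipoly A" "algebraic_bipoly B"
    and zero: "bipoly_eval A x y = 0" "bipoly_eval B x y = 0"
    and coprime: "\<And>\<pi>. prime_elem \<pi> \<Longrightarrow> \<pi> dvd A \<Longrightarrow> \<pi> dvd B \<Longrightarrow> bipoly_eval \<pi> x y \<noteq> 0"
  shows "algebraic x \<and> algebraic y"
proof -
  \<comment> \<open>The linear polynomial in the inner variable with zero \<open>x\<close> is prime
    and vanishes at the point, so by \<open>coprime\<close> it is not a common divisor.\<close>
  have lin: "\<not> ([:[:- x, 1:]:] dvd A \<and> [:[:- x, 1:]:] dvd B)"
    using coprime[OF prime_elem_x_minus, of x] by auto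
  have x: "algebraic x"
  proof (rule ccontr)
    assume nx: "\<not> algebraic x"
    define V where "V = {H. algebraic_bipoly H \<and> H \<noteq> 0 \<and> bipoly_eval H x y = 0}"
    have "A \<noteq> 0 \<or> B \<noteq> 0" using lin by auto
    then obtain H0 where "H0 \<in> V" using alg zero by (auto simp: V_def)
    then obtain G where G: "G \<in> V" and Gmin: "\<And>H. H \<in> V \<Longrightarrow> degree G \<le> degree H"
      using ex_has_least_nat[of "\<lambda>H. H \<in> V" H0 degree] by blast
    have G0: "G \<noteq> 0" "algebraic_bipoly G" "bipoly_eval G x y = 0" using G by (auto simp: V_def)
    \<comment> \<open>Pseudo-division in the outer variable: the multiplier \<open>l\<close> is free
      of it. Every remainder still vanishes at the point, so minimality of \<open>G\<close> forces
      the final remainder to be 0.\<close>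
    have pseudo: "\<exists>l U. l \<noteq> 0 \<and> Polynomial.smult l H = G * U"
      if "algebraic_bipoly H" "bipoly_eval H x y = 0" for H
      using that
    proof (induction "degree H" arbitrary: H rule: less_induct)
      case less
      show ?case
      proof (cases "degree H < degree G")
        case True
        then have "H = 0" using Gmin[of H] less.prems by (force simp: V_def)
        then show ?thesis by (intro exI[of _ 1] exI[of _ 0]) auto
      next
        case False
        define e where "e = degree H - degree G"
        define H' where "H' = Polynomial.smult (lead_coeff G) H - monom (lead_coeff H) e * G"
        show ?thesis
        \<comment> \<open>Cancelling the leading term lowers the degree only if it is positive. In
          degree 0, a polynomial in the inner variable with algebraic coefficients vanishes at a
          transcendental number, so it is 0.\<close>
        proof (cases "degree H = 0")
          case True
          then obtain h where h: "H = [:h:]" by (elim degree_eq_zeroE)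
          have "coeff H 0 = h" by (simp add: h)
          then have "algebraic_poly h" using less.prems(1) unfolding algebraic_bipoly_def by metis
          then have "H = 0" using less.prems(2) nx algebraic_poly_root[of h x] by (auto simp: h)
          then show ?thesis by (intro exI[of _ 1] exI[of _ 0]) auto
        next
          case dH: False
          have "coeff H' (degree H) = 0"
            using False by (simp add: H'_def e_def coeff_monom_mult)
          moreover have "degree H' \<le> degree H"
            unfolding H'_def using False
            by (intro degree_diff_le degree_smult_le order_trans[OF degree_mult_le])
               (auto simp: e_def intro: order_trans[OF add_right_mono[OF degree_monom_le]])
          ultimately have "degree H' < degree H"
            using dH by (metis degree_0 le_neq_implies_less leading_coeff_0_iff neq0_conv)
          moreover have "algebraic_bipoly H'"
            using less.prems(1) G0(2) unfolding algebraic_bipoly_def H'_def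
            by (auto simp: coeff_monom_mult intro!: algebraic_poly_diff algebraic_poly_mult algebraic_poly_0)
          moreover have "bipoly_eval H' x y = 0" using less.prems G0 by (simp add: H'_def)
          ultimately obtain l U where lU: "l \<noteq> 0" "Polynomial.smult l H' = G * U" using less.hyps by blast
          have "Polynomial.smult (l * lead_coeff G) H = Polynomial.smult l H' + Polynomial.smult l (monom (lead_coeff H) e * G)"
            by (simp add: H'_def smult_diff_right)
          also have "\<dots> = G * (U + Polynomial.smult l (monom (lead_coeff H) e))"
            by (simp add: lU algebra_simps)
          finally show ?thesis using lU(1) G0(1)
            by (intro exI[of _ "l * lead_coeff G"] exI[of _ "U + Polynomial.smult l (monom (lead_coeff H) e)"]) auto
        qed
      qed
    qed
    obtain \<pi> where \<pi>: "prime_elem \<pi>" "\<pi> dvd G" "bipoly_eval \<pi> x y = 0"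
      using prime_divisor_vanishing[OF G0(1,3)] .
    \<comment> \<open>A prime free of the outer variable would be divisible by the linear polynomial
      with zero \<open>x\<close>, forcing all coefficients of \<open>G\<close> to vanish at a
      transcendental number.\<close>
    have "degree \<pi> \<noteq> 0"
    proof
      assume "degree \<pi> = 0"
      then obtain p where p: "\<pi> = [:p:]" by (elim degree_eq_zeroE)
      then have "[:- x, 1:] dvd p" using \<pi>(3) by (simp add: poly_eq_0_iff_dvd)
      then have "[:[:- x, 1:]:] dvd G" using \<pi>(2) p by (meson const_poly_dvd_const_poly_iff dvd_trans)
      then have "poly (coeff G k) x = 0" for k by (simp add: x_minus_dvd_iff)
      then have "coeff G k = 0" for k
        using G0(2) nx algebraic_poly_root unfolding algebraic_bipoly_def by blast
      then show False using G0(1) by (simp add: poly_eq_iff)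
    qed
    then have nl: "\<not> \<pi> dvd [:l:]" if "l \<noteq> 0" for l
      using that dvd_imp_degree_le[of \<pi> "[:l:]"] by auto
    have "\<pi> dvd H" if H: "algebraic_bipoly H" "bipoly_eval H x y = 0" for H
    proof -
      obtain l U where l: "l \<noteq> 0" "Polynomial.smult l H = G * U" using pseudo[OF H] by blast
      then have "\<pi> dvd [:l:] * H" using \<pi>(2) by simp
      then show ?thesis
        using prime_elem_dvd_mult_iff[OF \<pi>(1), of "[:l:]" H] nl[OF l(1)] by blast
    qed
    then show False using coprime[OF \<pi>(1)] alg zero \<pi>(3) by blast
  qed
  \<comment> \<open>By \<open>lin\<close> one of \<open>A\<close> and \<open>B\<close> stays nonzero
    when the inner variable is specialised to \<open>x\<close>; it then has \<open>y\<close> as a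
    zero.\<close>
  have red: "algebraic y" if F: "algebraic_bipoly F" "bipoly_eval F x y = 0" "\<not> [:[:- x, 1:]:] dvd F" for F
  proof (rule algebraic_poly_root)
    show "poly (map_poly (\<lambda>p. poly p x) F) y = 0" using F by (simp add: bipoly_eval_swap)
    show "algebraic_poly (map_poly (\<lambda>p. poly p x) F)"
      using F(1) x by (auto simp: algebraic_poly_def[of "map_poly _ _"] coeff_map_poly
          algebraic_bipoly_def intro: algebraic_poly_eval)
    show "map_poly (\<lambda>p. poly p x) F \<noteq> 0"
      using F(3) by (auto simp: x_minus_dvd_iff poly_eq_iff coeff_map_poly)
  qed
  then show ?thesis using x lin alg zero by blast
qed

text \<open>
  The derivation with \<open>x \<mapsto> 1\<close> and \<open>y \<mapsto> \<i> y\<close>: it computes the derivative of \<open>F (x, cis x)\<close>.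
\<close>

definition cis_deriv :: "complex poly poly \<Rightarrow> complex poly poly" where
  "cis_deriv F = map_poly pderiv F + [:0, [:\<i>:]:] * pderiv F"

lemma coeff_cis_deriv: "coeff (cis_deriv F) k = pderiv (coeff F k) + Polynomial.smult (\<i> * of_nat k) (coeff F k)"
  by (cases k) (auto simp: cis_deriv_def coeff_map_poly coeff_pderiv of_nat_poly mult_ac)

lemma cis_deriv_pCons: "cis_deriv (pCons a F) = pCons (pderiv a) (cis_deriv F + Polynomial.smult [:\<i>:] F)"
  by (rule poly_eqI) (auto simp: coeff_cis_deriv coeff_pCons smult_add_left algebra_simps split: nat.splits)

lemma cis_deriv_add: "cis_deriv (F + G) = cis_deriv F + cis_deriv G"
  by (rule poly_eqI) (auto simp: coeff_cis_deriv pderiv_add smult_add_right)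

lemma cis_deriv_smult: "cis_deriv (Polynomial.smult a F) = Polynomial.smult (pderiv a) F + Polynomial.smult a (cis_deriv F)"
  by (rule poly_eqI) (auto simp: coeff_cis_deriv pderiv_mult algebra_simps)

lemma cis_deriv_mult: "cis_deriv (F * G) = cis_deriv F * G + F * cis_deriv G"
proof (induction F)
  case 0
  show ?case by (simp add: cis_deriv_def)
next
  case (pCons a F)
  have "cis_deriv (pCons a F * G) = cis_deriv (Polynomial.smult a G + pCons 0 (F * G))" by simp
  also have "\<dots> = cis_deriv (pCons a F) * G + pCons a F * cis_deriv G"
    by (simp add: cis_deriv_add cis_deriv_smult cis_deriv_pCons pCons.IH algebra_simps smult_add_right
        del: mult_pCons_left)
  finally show ?case .
qed

lemma cis_deriv_has_vector_derivative:
  "((\<lambda>x. bipoly_eval F (of_real x) (cis x)) has_vector_derivative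
     bipoly_eval (cis_deriv F) (of_real x) (cis x)) (at x)"
proof (induction F)
  case 0
  show ?case by (simp add: cis_deriv_def)
next
  case (pCons a F)
  have c: "(cis has_vector_derivative (\<i> * cis x)) (at x)"
    unfolding has_vector_derivative_def using has_derivative_cis[OF has_derivative_ident] .
  have p: "((\<lambda>x. poly a (of_real x)) has_vector_derivative poly (pderiv a) (of_real x)) (at x)"
    by (rule has_vector_derivative_real_field[OF poly_DERIV])
  show ?case
    unfolding bipoly_eval_simps cis_deriv_pCons
    by (rule has_vector_derivative_eq_rhs[OF has_vector_derivative_add[OF p has_vector_derivative_mult[OF c pCons.IH]]])
       (simp add: algebra_simps)
qed

text \<open>The derivation raises the degree neither in y nor in x, so the quotient is a constant
  \<open>l\<close>. Coefficientwise this reads a_k' = (l - \<i> k) a_k; comparing degrees, a nonzero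
  a_k has l = \<i> k and is constant, and only one \<open>k\<close> is possible.\<close>

lemma dvd_cis_deriv_imp_monom:
  assumes F: "F \<noteq> 0" and dvd: "F dvd cis_deriv F"
  obtains c k where "c \<noteq> 0" "F = monom [:c:] k"
proof -
  obtain U where U: "cis_deriv F = F * U" using dvd by (elim dvdE)
  have degD: "degree (cis_deriv F) \<le> degree F"
    by (rule degree_le) (auto simp: coeff_cis_deriv coeff_eq_0)
  have "degree U = 0"
  proof (cases "U = 0")
    case False
    then have "degree F + degree U \<le> degree F" using degD F by (simp add: U degree_mult_eq)
    then show ?thesis by simp
  qed auto
  then obtain u where u: "U = [:u:]" by (elim degree_eq_zeroE)
  have eq: "pderiv (coeff F k) + Polynomial.smult (\<i> * of_nat k) (coeff F k) = coeff F k * u" for k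
    using arg_cong[OF U, of "\<lambda>p. coeff p k"] by (simp add: u coeff_cis_deriv mult.commute)
  have "degree u = 0"
  proof (cases "u = 0")
    case False
    let ?f = "lead_coeff F"
    have f: "?f \<noteq> 0" using F by simp
    have "degree ?f + degree u = degree (?f * u)" using f False by (simp add: degree_mult_eq)
    also have "\<dots> \<le> degree ?f"
      unfolding eq[symmetric] by (rule degree_add_le) (auto simp: degree_pderiv)
    finally show ?thesis by simp
  qed auto
  then obtain l where l: "u = [:l:]" by (elim degree_eq_zeroE)
  have const: "l = \<i> * of_nat k \<and> degree (coeff F k) = 0" if k: "coeff F k \<noteq> 0" for k
  proof -
    have eq': "pderiv (coeff F k) = Polynomial.smult (l - \<i> * of_nat k) (coeff F k)"
      using eq[of k] by (simp add: l smult_diff_left algebra_simps)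
    have "l = \<i> * of_nat k"
    proof (rule ccontr)
      assume ne: "l \<noteq> \<i> * of_nat k"
      then have "degree (coeff F k) = degree (coeff F k) - 1"
        using arg_cong[OF eq', of degree] by (simp add: degree_pderiv)
      then have "degree (coeff F k) = 0" by simp
      then have "pderiv (coeff F k) = 0" by (auto elim: degree_eq_zeroE)
      then show False using eq' ne k by simp
    qed
    then show ?thesis using eq' by (simp add: pderiv_eq_0_iff)
  qed
  define n where "n = degree F"
  have n: "coeff F n \<noteq> 0" using F by (simp add: n_def)
  obtain c where c: "coeff F n = [:c:]" using const[OF n] by (elim conjE degree_eq_zeroE)
  have "coeff F k = coeff (monom [:c:] n) k" for k
  proof (cases "coeff F k = 0")
    case True then show ?thesis using c n by auto
  next
    case False
    then have "\<i> * of_nat k = \<i> * of_nat n" using const n by metis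
    then have "k = n" by simp
    then show ?thesis using c by simp
  qed
  then have "F = monom [:c:] n" by (rule poly_eqI)
  moreover have "c \<noteq> 0" using c n by auto
  ultimately show ?thesis using that by blast
qed

lemma algebraic_cis_imp_0:
  fixes x :: real
  assumes "algebraic (complex_of_real x)" "algebraic (cis x)"
  shows "x = 0"
proof (rule ccontr)
  assume "x \<noteq> 0"
  moreover have "algebraic (\<i> * complex_of_real x)" using assms(1) by (intro algebraic_mult) auto
  ultimately have "\<not> algebraic (exp (\<i> * complex_of_real x))" by (intro hermite_lindemann) auto
  then show False using assms(2) by (simp add: cis_conv_exp)
qed

lemma coprime_common_zero:
  assumes "algebraic_bipoly F" "algebraic_bipoly G" "coprime F G"
    and "bipoly_eval F (of_real x) (cis x) = 0" "bipoly_eval G (of_real x) (cis x) = 0"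
  shows "x = 0"
proof (rule algebraic_cis_imp_0)
  have "\<not> (\<pi> dvd F \<and> \<pi> dvd G)" if "prime_elem \<pi>" for \<pi>
    using assms(3) that coprime_common_divisor prime_elem_not_unit by blast
  then have "algebraic (complex_of_real x) \<and> algebraic (cis x)"
    using assms by (intro common_zero_algebraic[of F G]) auto
  then show "algebraic (complex_of_real x)" "algebraic (cis x)" by auto
qed

lemma squarefree_multiple_zero:
  assumes F: "algebraic_bipoly F" "squarefree F" "F \<noteq> 0"
    and zero: "bipoly_eval F (of_real x) (cis x) = 0" "bipoly_eval (cis_deriv F) (of_real x) (cis x) = 0"
  shows "x = 0"
proof (rule algebraic_cis_imp_0)
  have "algebraic_bipoly (cis_deriv F)"
    using F(1) unfolding algebraic_bipoly_def coeff_cis_deriv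
    by (auto intro!: algebraic_poly_add algebraic_poly_pderiv)
       (auto simp: algebraic_poly_def intro!: algebraic_mult algebraic_of_nat)
  moreover have "bipoly_eval \<pi> (of_real x) (cis x) \<noteq> 0"
    if \<pi>: "prime_elem \<pi>" "\<pi> dvd F" "\<pi> dvd cis_deriv F" for \<pi>
  proof -
    obtain H where H: "F = \<pi> * H" using \<pi>(2) by (elim dvdE)
    have "\<pi> dvd cis_deriv \<pi> * H + \<pi> * cis_deriv H" using \<pi>(3) by (simp add: H cis_deriv_mult)
    then have "\<pi> dvd cis_deriv \<pi> * H" by (simp add: dvd_add_left_iff)
    then have "\<pi> dvd cis_deriv \<pi> \<or> \<pi> dvd H" using \<pi>(1) by (simp add: prime_elem_dvd_mult_iff)
    moreover have "\<not> \<pi> dvd H"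
    proof
      assume "\<pi> dvd H"
      then have "\<pi>\<^sup>2 dvd F" by (simp add: H power2_eq_square)
      then show False using F(2) \<pi>(1) squarefreeD prime_elem_not_unit by blast
    qed
    ultimately have "\<pi> dvd cis_deriv \<pi>" by blast
    \<comment> \<open>Monomials in y have no zero on the curve, because \<open>cis x\<close> is
      never 0.\<close>
    then obtain c k where "c \<noteq> 0" "\<pi> = monom [:c:] k"
      using dvd_cis_deriv_imp_monom \<pi>(1) by (metis prime_elem_not_zeroI)
    then show ?thesis by simp
  qed
  ultimately have "algebraic (complex_of_real x) \<and> algebraic (cis x)"
    using F zero by (intro common_zero_algebraic[of F "cis_deriv F"]) auto
  then show "algebraic (complex_of_real x)" "algebraic (cis x)" by auto
qed

subsection \<open>Laurent polynomials and conjugation\<close>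

lemma of_bipoly_altdef:
  assumes "degree Q \<le> n"
  shows "of_bipoly Q = (\<Sum>k\<le>n. Poly_Mapping.single (of_nat k) (coeff Q k))"
  unfolding of_bipoly_def using assms by (intro sum.mono_neutral_left) (auto simp: coeff_eq_0)

lemma of_bipoly_0: "of_bipoly 0 = 0"
  by (simp add: of_bipoly_def)

lemma of_bipoly_add: "of_bipoly (F + G) = of_bipoly F + of_bipoly G"
proof -
  let ?n = "max (degree F) (degree G)"
  show ?thesis
    by (subst (1 2 3) of_bipoly_altdef[of _ ?n])
       (auto simp: degree_add_le sum.distrib[symmetric] single_add)
qed

lemma of_bipoly_pCons: "of_bipoly (pCons a F) = Poly_Mapping.single 0 a + y_pow 1 * of_bipoly F"
proof -
  have "of_bipoly (pCons a F) =
      (\<Sum>k\<le>Suc (degree F). Poly_Mapping.single (of_nat k) (coeff (pCons a F) k))"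
    by (rule of_bipoly_altdef) (simp add: degree_pCons_le)
  then show ?thesis
    by (simp add: sum.atMost_Suc_shift of_bipoly_def y_pow_def sum_distrib_left mult_single del: sum.atMost_Suc)
qed

lemma of_bipoly_smult: "of_bipoly (Polynomial.smult a F) = Poly_Mapping.single 0 a * of_bipoly F"
  by (subst of_bipoly_altdef[of _ "degree F"])
     (auto simp: of_bipoly_def sum_distrib_left mult_single)

lemma of_bipoly_mult: "of_bipoly (F * G) = of_bipoly F * of_bipoly G"
proof (induction F)
  case (pCons a F)
  have "of_bipoly (pCons 0 (F * G)) = y_pow 1 * of_bipoly (F * G)" by (simp add: of_bipoly_pCons)
  then show ?case
    by (simp add: of_bipoly_add of_bipoly_smult of_bipoly_pCons pCons.IH algebra_simps)
qed (simp add: of_bipoly_0)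

lemma of_bipoly_1: "of_bipoly 1 = 1"
  by (simp add: of_bipoly_def)

lemma of_bipoly_power: "of_bipoly (F ^ n) = of_bipoly F ^ n"
  by (induction n) (auto simp: of_bipoly_1 of_bipoly_mult)

lemma of_bipoly_prod: "of_bipoly (\<Prod>i\<in>I. F i) = (\<Prod>i\<in>I. of_bipoly (F i))"
  by (induction I rule: infinite_finite_induct) (auto simp: of_bipoly_1 of_bipoly_mult)

lemma lookup_of_bipoly: "Poly_Mapping.lookup (of_bipoly F) (of_nat k) = coeff F k"
  by (simp add: of_bipoly_def lookup_sum lookup_single when_def coeff_eq_0)

lemma of_bipoly_inject: "of_bipoly F = of_bipoly G \<longleftrightarrow> F = G"
  by (metis lookup_of_bipoly poly_eqI)

lemma y_pow_0: "y_pow 0 = 1" and y_pow_add: "y_pow (v + w) = y_pow v * y_pow w"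
  by (simp_all add: y_pow_def mult_single)

lemma y_pow_power: "y_pow v ^ n = y_pow (of_nat n * v)"
  by (induction n) (auto simp: y_pow_0 y_pow_add distrib_right)

lemma y_pow_prod: "(\<Prod>i\<in>I. y_pow (v i)) = y_pow (\<Sum>i\<in>I. v i)"
  by (induction I rule: infinite_finite_induct) (auto simp: y_pow_0 y_pow_add)

lemma of_bipoly_monom: "of_bipoly (monom 1 n) = y_pow (of_nat n)"
  by (induction n) (auto simp: monom_0 monom_Suc of_bipoly_pCons of_bipoly_1 y_pow_0 y_pow_add
    simp flip: one_pCons)

lemma const_L_mult: "const_L (c * d) = const_L c * const_L d"
  by (simp add: const_L_def mult_single mult.commute)

lemma const_L_1: "const_L 1 = 1"
  by (simp add: const_L_def flip: one_pCons)

lemma const_L_power: "const_L (c ^ n) = const_L c ^ n"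
  by (induction n) (auto simp: const_L_1 const_L_mult)

lemma const_L_prod: "const_L (\<Prod>i\<in>I. c i) = (\<Prod>i\<in>I. const_L (c i))"
  by (induction I rule: infinite_finite_induct) (auto simp: const_L_1 const_L_mult)

section \<open>Conjugation of Laurent polynomials\<close>

lemma map_poly_cnj_mult: "map_poly cnj (p * q) = map_poly cnj p * map_poly cnj q"
  by (rule poly_eqI) (simp add: coeff_map_poly coeff_mult)

lemma map_poly_cnj_add: "map_poly cnj (p + q) = map_poly cnj p + map_poly cnj q"
  by (rule poly_eqI) (simp add: coeff_map_poly)

lemma map_poly_cnj_cnj: "map_poly cnj (map_poly cnj p) = p"
  by (rule poly_eqI) (simp add: coeff_map_poly)

lemma map_poly_const: "f 0 = 0 \<Longrightarrow> map_poly f [:c:] = [:f c:]"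
  by (rule poly_eqI) (simp add: coeff_map_poly coeff_pCons split: nat.split)

lemma map_poly_cnj_sum: "map_poly cnj (\<Sum>i\<in>I. f i) = (\<Sum>i\<in>I. map_poly cnj (f i))"
  by (induction I rule: infinite_finite_induct) (auto simp: map_poly_cnj_add)

lemma map_poly_cnj_eq_0_iff: "map_poly cnj p = 0 \<longleftrightarrow> p = 0"
  by (metis map_poly_0 map_poly_cnj_cnj complex_cnj_zero)

interpretation con: pm_eval_hom "\<lambda>a. Poly_Mapping.single 0 (map_poly cnj a) :: gen_laurent"
  "\<lambda>v. Poly_Mapping.single (- v) 1"
  by unfold_locales
    (auto simp: map_poly_cnj_add map_poly_cnj_mult single_add mult_single)

lemma con_eq: "con = pm_eval (\<lambda>a. Poly_Mapping.single 0 (map_poly cnj a)) (\<lambda>v. Poly_Mapping.single (- v) 1)"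
  by (rule ext) (simp add: con_def pm_eval_def mult_single)

lemma con_single: "con (Poly_Mapping.single v a) = Poly_Mapping.single (- v) (map_poly cnj a)"
  by (simp add: con_eq mult_single)

lemma con_y_pow: "con (y_pow v) = y_pow (- v)"
  by (simp add: y_pow_def con_single)

lemma con_const_L: "con (const_L c) = const_L (cnj c)"
  by (simp add: const_L_def con_single map_poly_const)

lemma con_mult: "con (P * Q) = con P * con Q"
  and con_power: "con (P ^ n) = con P ^ n"
  and con_prod: "con (\<Prod>i\<in>I. F i) = (\<Prod>i\<in>I. con (F i))"
  and con_sum: "con (\<Sum>i\<in>I. F i) = (\<Sum>i\<in>I. con (F i))"
  by (simp_all add: con_eq con.eval_mult con.eval_power con.eval_prod con.eval_sum)

lemma con_con: "con (con P) = P"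
proof -
  have "con (con P) = (\<Sum>v\<in>Poly_Mapping.keys P. Poly_Mapping.single v (Poly_Mapping.lookup P v))"
    by (simp add: con_def[of P] con_sum con_single map_poly_cnj_cnj)
  also have "\<dots> = P"
    by (rule poly_mapping_eqI) (auto simp: lookup_sum lookup_single when_def in_keys_iff)
  finally show ?thesis .
qed

text \<open>Multiplication by y^(degree F) clears the negative exponents of
  \<open>con (of_bipoly F)\<close>; this is the resulting polynomial. It carries conjugation into
  the factorial ring of polynomials in x and y.\<close>

definition conj_reflect :: "complex poly poly \<Rightarrow> complex poly poly" where
  "conj_reflect F = reflect_poly (map_poly (map_poly cnj) F)"

lemma con_of_bipoly: "con (of_bipoly F) = y_pow (- of_nat (degree F)) * of_bipoly (conj_reflect F)"
proof -
  let ?F = "map_poly (map_poly cnj) F" and ?d = "degree F"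
  have d: "degree ?F = ?d" by (rule degree_map_poly) (simp add: map_poly_cnj_eq_0_iff)
  have c: "coeff (conj_reflect F) k = (if k > ?d then 0 else map_poly cnj (coeff F (?d - k)))" for k
    by (simp add: conj_reflect_def coeff_reflect_poly d coeff_map_poly)
  have "y_pow (- of_nat ?d) * of_bipoly (conj_reflect F) =
      (\<Sum>k\<le>?d. Poly_Mapping.single (- of_nat ?d + of_nat k) (map_poly cnj (coeff F (?d - k))))"
    using degree_reflect_poly_le[of ?F]
    by (subst of_bipoly_altdef[of _ ?d])
       (auto simp: conj_reflect_def[symmetric] d sum_distrib_left y_pow_def mult_single c)
  also have "\<dots> = (\<Sum>k\<le>?d. Poly_Mapping.single (- of_nat k) (map_poly cnj (coeff F k)))"
    by (rule sum.reindex_bij_witness[of _ "\<lambda>k. ?d - k" "\<lambda>k. ?d - k"]) (auto simp: of_nat_diff)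
  also have "\<dots> = con (of_bipoly F)"
    by (simp add: of_bipoly_def con_sum con_single)
  finally show ?thesis by simp
qed

lemma conj_reflect_mult: "conj_reflect (F * G) = conj_reflect F * conj_reflect G"
proof -
  have "map_poly (map_poly cnj) (F * G) = map_poly (map_poly cnj) F * map_poly (map_poly cnj) G"
    by (rule poly_eqI) (simp add: coeff_map_poly coeff_mult map_poly_cnj_sum map_poly_cnj_mult)
  then show ?thesis by (simp add: conj_reflect_def reflect_poly_mult)
qed

lemma conj_reflect_const: "conj_reflect [:p:] = [:map_poly cnj p:]"
  by (simp add: conj_reflect_def map_poly_const)

lemma conj_reflect_1: "conj_reflect 1 = 1"
  by (simp add: conj_reflect_def)

lemma conj_reflect_power: "conj_reflect (F ^ n) = conj_reflect F ^ n"
  by (induction n) (auto simp: conj_reflect_mult conj_reflect_1)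

lemma conj_reflect_eq_0_iff: "conj_reflect F = 0 \<longleftrightarrow> F = 0"
  unfolding conj_reflect_def reflect_poly_eq_0_iff
  by (auto simp: poly_eq_iff[of F] poly_eq_iff[of "map_poly (map_poly cnj) F"] coeff_map_poly map_poly_cnj_eq_0_iff)

lemma coeff_0_conj_reflect: "coeff (conj_reflect F) 0 = 0 \<longleftrightarrow> F = 0"
  using conj_reflect_eq_0_iff[of F] by (simp add: conj_reflect_def)

text \<open>Reflection discards the powers of y dividing \<open>F\<close>, so it is an involution
  only where there are none.\<close>

lemma conj_reflect_conj_reflect:
  assumes "coeff F 0 \<noteq> 0"
  shows "conj_reflect (conj_reflect F) = F"
proof -
  let ?h = "map_poly (map_poly cnj) :: complex poly poly \<Rightarrow> _"
  have d: "degree (?h F) = degree F" for F by (rule degree_map_poly) (simp add: map_poly_cnj_eq_0_iff)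
  have "?h (reflect_poly G) = reflect_poly (?h G)" for G
    by (rule poly_eqI) (simp add: coeff_map_poly coeff_reflect_poly d)
  moreover have "?h (?h F) = F" by (rule poly_eqI) (simp add: coeff_map_poly map_poly_cnj_cnj)
  ultimately show ?thesis using assms by (simp add: conj_reflect_def)
qed

lemma degree_conj_reflect:
  assumes "coeff F 0 \<noteq> 0"
  shows "degree (conj_reflect F) = degree F"
proof -
  have "coeff (map_poly (map_poly cnj) F) 0 \<noteq> 0" using assms by (simp add: coeff_map_poly map_poly_cnj_eq_0_iff)
  moreover have "degree (map_poly (map_poly cnj) F) = degree F"
    by (rule degree_map_poly) (simp add: map_poly_cnj_eq_0_iff)
  ultimately show ?thesis by (simp add: conj_reflect_def)
qed

text \<open>Passing from \<open>F\<close> to \<open>F'\<close> restores the involution without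
  changing the reflection, as y itself is reflected to 1.\<close>

lemma split_y_power:
  fixes F :: "complex poly poly"
  assumes "F \<noteq> 0"
  obtains k F' where "F = monom 1 k * F'" "coeff F' 0 \<noteq> 0" "conj_reflect F' = conj_reflect F"
  using assms
proof (induction F arbitrary: thesis)
  case (pCons a F)
  show ?case
  proof (cases "a = 0")
    case False
    then show ?thesis using pCons.prems(1)[of 0 "pCons a F"] by (simp flip: one_pCons add: monom_0)
  next
    case True
    then have "F \<noteq> 0" using pCons.prems(2) by auto
    then obtain k F' where F': "F = monom 1 k * F'" "coeff F' 0 \<noteq> 0" "conj_reflect F' = conj_reflect F"
      using pCons.IH by blast
    have "pCons a F = monom 1 (Suc k) * F'" using True F'(1) by (simp add: monom_Suc)
    moreover have "conj_reflect (pCons a F) = conj_reflect [:0, 1:] * conj_reflect F"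
      using True by (simp flip: conj_reflect_mult)
    moreover have "conj_reflect [:0, 1:] = 1"
      by (simp add: conj_reflect_def map_poly_pCons reflect_poly_pCons' flip: one_pCons)
    ultimately show ?thesis using pCons.prems(1)[of "Suc k" F'] F' by simp
  qed
qed auto

section \<open>Multiplicities of irreducible factors\<close>

lemma multiplicity_prod_coprime_powers:
  fixes A :: "'i \<Rightarrow> 'a::factorial_semiring"
  assumes fin: "finite I" and nz: "\<And>j. j \<in> I \<Longrightarrow> A j \<noteq> 0" and \<pi>: "prime_elem \<pi>"
    and i: "i \<in> I" "\<pi> dvd A i" "\<not> \<pi>\<^sup>2 dvd A i" and other: "\<And>j. j \<in> I \<Longrightarrow> j \<noteq> i \<Longrightarrow> \<not> \<pi> dvd A j"
  shows "multiplicity \<pi> (\<Prod>j\<in>I. A j ^ r j) = r i"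
proof -
  have m: "multiplicity \<pi> (A j) = (if j = i then 1 else 0)" if "j \<in> I" for j
    using i(2,3) other[OF that] by (auto intro!: multiplicity_eqI simp: power2_eq_square)
  have "multiplicity \<pi> (\<Prod>j\<in>I. A j ^ r j) = (\<Sum>j\<in>I. multiplicity \<pi> (A j ^ r j))"
    using nz by (intro prime_elem_multiplicity_prod_distrib[OF \<pi> _ fin]) auto
  also have "\<dots> = (\<Sum>j\<in>I. if j = i then r i else 0)"
    using nz by (intro sum.cong) (auto simp: prime_elem_multiplicity_power_distrib[OF \<pi>] m)
  also have "\<dots> = r i" using fin i(1) by simp
  finally show ?thesis .
qed

lemma dvd_if_prime_divisors_dvd:
  fixes a b :: "'a::factorial_semiring"
  assumes "a \<noteq> 0" "squarefree a" "\<And>\<pi>. prime \<pi> \<Longrightarrow> \<pi> dvd a \<Longrightarrow> \<pi> dvd b"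
  shows "a dvd b"
proof (cases "b = 0")
  case False
  show ?thesis
  proof (rule multiplicity_le_imp_dvd[OF assms(1)])
    fix \<pi> :: 'a assume \<pi>: "prime \<pi>"
    have "multiplicity \<pi> a < 2"
      using assms(2) \<pi> not_prime_unit by (intro multiplicity_lessI) (auto simp: assms(1) dest: squarefreeD)
    moreover have "multiplicity \<pi> b \<ge> 1" if "\<pi> dvd a"
      using assms(3)[OF \<pi> that] \<pi> False by (intro multiplicity_geI) auto
    moreover have "multiplicity \<pi> a = 0" if "\<not> \<pi> dvd a"
      using that by (rule not_dvd_imp_multiplicity_0)
    ultimately show "multiplicity \<pi> a \<le> multiplicity \<pi> b" by fastforce
  qed
qed auto

lemma is_unit_conj_reflect: "is_unit (conj_reflect F) \<Longrightarrow> coeff F 0 \<noteq> 0 \<Longrightarrow> is_unit F"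
  by (metis conj_reflect_mult conj_reflect_conj_reflect conj_reflect_1 dvd_def)

text \<open>
  An irreducible factor of \<open>Q i\<close> other than \<open>y\<close> has multiplicity \<open>r i\<close> on both sides; since the
  \<open>r i\<close> are distinct, it divides \<open>conj_reflect (Q i)\<close>.
\<close>

lemma conj_reflect_factor:
  assumes fin: "finite I" and nz: "\<And>i. i \<in> I \<Longrightarrow> Q i \<noteq> 0" "C \<noteq> 0" "D \<noteq> 0"
    and eq: "monom 1 a * (Polynomial.smult [:C:] (\<Prod>i\<in>I. Q i ^ r i)) =
      monom 1 b * (Polynomial.smult [:D:] (\<Prod>i\<in>I. conj_reflect (Q i) ^ r i))"
    and r: "\<And>i. i \<in> I \<Longrightarrow> r i \<ge> (1::nat)" "inj_on r I"
    and sqf: "\<And>i. i \<in> I \<Longrightarrow> squarefree (Q i)"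
    and cop: "\<And>i j. i \<in> I \<Longrightarrow> j \<in> I \<Longrightarrow> i \<noteq> j \<Longrightarrow> coprime (Q i) (Q j)"
    and i: "i \<in> I"
  obtains w k where "w \<noteq> 0" "monom 1 k * conj_reflect (Q i) = Polynomial.smult [:w:] (Q i)"
proof -
  have nzT: "conj_reflect (Q j) \<noteq> 0" if "j \<in> I" for j using nz(1)[OF that] by (simp add: conj_reflect_eq_0_iff)
  \<comment> \<open>Divisibility is carried back from the reflection to \<open>Q j\<close>, where
    squarefreeness and coprimality are given.\<close>
  have Tdvd: "conj_reflect \<pi> ^ n dvd Q j" if j: "j \<in> I" "\<pi> ^ n dvd conj_reflect (Q j)" for \<pi> n j
  proof -
    obtain k F where F: "Q j = monom 1 k * F" "coeff F 0 \<noteq> 0" "conj_reflect F = conj_reflect (Q j)"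
      using split_y_power[OF nz(1)[OF j(1)]] .
    obtain H where "conj_reflect (Q j) = \<pi> ^ n * H" using j(2) by (elim dvdE)
    then have "conj_reflect (conj_reflect F) = conj_reflect (\<pi> ^ n) * conj_reflect H"
      by (simp add: F(3) conj_reflect_mult)
    then have "F = conj_reflect \<pi> ^ n * conj_reflect H" using F(2) by (simp add: conj_reflect_conj_reflect conj_reflect_power)
    then show ?thesis using F(1) by simp
  qed
  have T0: "coeff \<pi> 0 \<noteq> 0" if "j \<in> I" "\<pi> dvd conj_reflect (Q j)" for \<pi> j
    using that nz(1)[OF that(1)] coeff_0_conj_reflect[of "Q j"] by (auto simp: coeff_mult elim!: dvdE)
  have Tunit: "\<not> is_unit (conj_reflect \<pi>)" if "j \<in> I" "\<pi> dvd conj_reflect (Q j)" "prime_elem \<pi>" for \<pi> j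
    using is_unit_conj_reflect[of \<pi>] T0[OF that(1,2)] that(3) prime_elem_not_unit by blast
  have multT: "multiplicity \<pi> (\<Prod>j\<in>I. conj_reflect (Q j) ^ r j) = r j"
    if j: "j \<in> I" "\<pi> dvd conj_reflect (Q j)" and \<pi>: "prime_elem \<pi>" for \<pi> j
  proof (rule multiplicity_prod_coprime_powers[where A = "\<lambda>j. conj_reflect (Q j)", OF fin nzT \<pi> j])
    show "\<not> \<pi>\<^sup>2 dvd conj_reflect (Q j)"
      using Tdvd[OF j(1), of \<pi> 2] Tunit[OF j \<pi>] sqf[OF j(1)] by (auto dest: squarefreeD)
    fix j' assume j': "j' \<in> I" "j' \<noteq> j"
    show "\<not> \<pi> dvd conj_reflect (Q j')"
    proof
      assume "\<pi> dvd conj_reflect (Q j')"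
      then have "conj_reflect \<pi> dvd Q j'" "conj_reflect \<pi> dvd Q j"
        using Tdvd[OF j'(1), of \<pi> 1] Tdvd[OF j(1), of \<pi> 1] j by auto
      then show False using cop[OF j'(1) j(1) j'(2)] Tunit[OF j \<pi>] coprime_common_divisor by blast
    qed
  qed
  have multQ: "multiplicity \<pi> (\<Prod>j\<in>I. Q j ^ r j) = r j"
    if j: "j \<in> I" "\<pi> dvd Q j" and \<pi>: "prime_elem \<pi>" for \<pi> j
  proof (rule multiplicity_prod_coprime_powers[where A = Q, OF fin nz(1) \<pi> j])
    show "\<not> \<pi>\<^sup>2 dvd Q j"
      using sqf[OF j(1)] prime_elem_not_unit[OF \<pi>] by (auto dest: squarefreeD)
    fix j' assume j': "j' \<in> I" "j' \<noteq> j"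
    then show "\<not> \<pi> dvd Q j'"
      using cop[OF j'(1) j(1) j'(2)] j(2) prime_elem_not_unit[OF \<pi>] coprime_common_divisor by blast
  qed
  \<comment> \<open>Monomials in y and constants are invisible to a prime with nonzero constant
    coefficient, that is, one not associated with y.\<close>
  have mult_unit: "multiplicity \<pi> (monom 1 n * (Polynomial.smult [:c:] F)) = multiplicity \<pi> F"
    if \<pi>: "prime_elem \<pi>" "coeff \<pi> 0 \<noteq> 0" and c: "c \<noteq> 0" and F: "F \<noteq> 0"
    for \<pi> F :: "complex poly poly" and n c
  proof -
    have y: "\<not> \<pi> dvd [:0, 1:]"
    proof
      assume "\<pi> dvd [:0, 1:]"
      then obtain H where H: "[:0, 1:] = \<pi> * H" by (elim dvdE)
      have "coeff H 0 = 0" using arg_cong[OF H, of "\<lambda>p. coeff p 0"] \<pi>(2) by (simp add: coeff_mult)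
      then obtain H' where H': "H = [:0, 1:] * H'" by (metis dvdE poly_0_coeff_0 poly_eq_0_iff_dvd minus_zero)
      have "[:0, 1:] * 1 = [:0, 1:] * (\<pi> * H')"
        using H unfolding H' by (metis mult.left_commute mult_1_right)
      then have "1 = \<pi> * H'" by (metis mult_left_cancel pCons_eq_0_iff zero_neq_one)
      then show False using \<pi>(1) by (metis dvdI prime_elem_not_unit)
    qed
    have "\<not> \<pi> dvd monom 1 n"
      using y prime_elem_dvd_power[OF \<pi>(1), of "[:0, 1:]" n] by (auto simp: monom_altdef)
    then have "multiplicity \<pi> (monom 1 n) = 0" by (rule not_dvd_imp_multiplicity_0)
    moreover have "is_unit [:[:c:]:]" using c by (simp add: is_unit_const_poly_iff dvd_field_iff)
    then have "multiplicity \<pi> ([:[:c:]:] * F) = multiplicity \<pi> F" by (rule multiplicity_times_unit_right)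
    ultimately show ?thesis
      using c F by (subst prime_elem_multiplicity_mult_distrib[OF \<pi>(1)]) auto
  qed
  \<comment> \<open>The power of y is split off first, since the comparison of multiplicities says
    nothing about the prime y.\<close>
  obtain k F where F: "Q i = monom 1 k * F" "coeff F 0 \<noteq> 0" "conj_reflect F = conj_reflect (Q i)"
    using split_y_power[OF nz(1)[OF i]] .
  have F0: "F \<noteq> 0" using F(2) by auto
  have "F dvd conj_reflect F"
  proof (rule dvd_if_prime_divisors_dvd[OF F0])
    show "squarefree F" using sqf[OF i] F(1) by (metis dvd_triv_right squarefree_mono)
    fix \<pi> assume \<pi>: "prime \<pi>" "\<pi> dvd F"
    have pe: "prime_elem \<pi>" using \<pi>(1) by auto
    have \<pi>0: "coeff \<pi> 0 \<noteq> 0" using \<pi>(2) F(2) by (auto simp: coeff_mult elim!: dvdE)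
    have "r i = multiplicity \<pi> (\<Prod>j\<in>I. Q j ^ r j)" using multQ[OF i _ pe] \<pi>(2) F(1) by simp
    also have "\<dots> = multiplicity \<pi> (monom 1 a * (Polynomial.smult [:C:] (\<Prod>i\<in>I. Q i ^ r i)))"
      using nz fin by (subst mult_unit[OF pe \<pi>0]) auto
    also have "\<dots> = multiplicity \<pi> (\<Prod>j\<in>I. conj_reflect (Q j) ^ r j)"
      unfolding eq using nz nzT fin by (subst mult_unit[OF pe \<pi>0]) auto
    finally have m: "multiplicity \<pi> (\<Prod>j\<in>I. conj_reflect (Q j) ^ r j) = r i" by simp
    then have "\<pi> dvd (\<Prod>j\<in>I. conj_reflect (Q j) ^ r j)"
      using r(1)[OF i] not_dvd_imp_multiplicity_0[of \<pi>] by fastforce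
    then have "\<exists>j\<in>I. \<pi> dvd conj_reflect (Q j) ^ r j"
      by (simp only: prime_dvd_prod_iff[OF fin \<pi>(1)])
    then obtain j where j: "j \<in> I" "\<pi> dvd conj_reflect (Q j)"
      using prime_elem_dvd_power[OF pe] by auto
    have "r j = r i" using multT[OF j pe] m by simp
    then have "j = i" using r(2) j(1) i by (auto simp: inj_on_def)
    then show "\<pi> dvd conj_reflect F" using j(2) F(3) by simp
  qed
  then obtain V where V: "conj_reflect F = F * V" by (elim dvdE)
  have V0: "V \<noteq> 0" using V F0 conj_reflect_eq_0_iff[of F] by auto
  \<comment> \<open>Reflection preserves the y-degree of \<open>F\<close>, so the quotient depends
    on x only; reflecting once more makes it a unit, hence a constant.\<close>
  have "degree F = degree F + degree V"
    using arg_cong[OF V, of degree] F0 V0 degree_conj_reflect[OF F(2)] by (simp add: degree_mult_eq)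
  then obtain v where v: "V = [:v:]" by (auto elim: degree_eq_zeroE)
  have "F = conj_reflect (conj_reflect F)" using F(2) by (simp add: conj_reflect_conj_reflect)
  also have "\<dots> = F * [:v:] * [:map_poly cnj v:]"
    by (simp only: V v conj_reflect_mult conj_reflect_const)
  finally have "F * 1 = F * [:v * map_poly cnj v:]" by (simp add: mult.commute)
  then have "1 = [:v * map_poly cnj v:]" using F0 by (metis mult_left_cancel)
  then have "is_unit v" by (metis dvdI one_pCons pCons_eq_iff)
  then have "v \<noteq> 0" "degree v = 0" by auto
  then obtain w where w: "v = [:w:]" "w \<noteq> 0" by (auto elim: degree_eq_zeroE)
  have "conj_reflect (Q i) = F * [:[:w:]:]" by (simp only: F(3)[symmetric] V v w(1))
  then have "monom 1 k * conj_reflect (Q i) = Polynomial.smult [:w:] (Q i)" by (simp add: F(1))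
  then show ?thesis using that w(2) by blast
qed

section \<open>Evaluation at y = exp (\<i> x) and normalisation of the factors\<close>

lemma LRhom_eq: "LRhom P x = pm_eval (\<lambda>a. poly a (complex_of_real x)) (\<lambda>v. cis (of_rat v * x)) P"
  by (simp add: LRhom_def pm_eval_def)

lemma LRhom_hom: "pm_eval_hom (\<lambda>a. poly a (complex_of_real x)) (\<lambda>v. cis (of_rat v * x))"
  by unfold_locales (auto simp: of_rat_add distrib_right cis_mult)

lemma LRhom_single: "LRhom (Poly_Mapping.single v a) x = poly a (of_real x) * cis (of_rat v * x)"
  and LRhom_0: "LRhom 0 x = 0"
  and LRhom_add: "LRhom (P + Q) x = LRhom P x + LRhom Q x"
  and LRhom_mult: "LRhom (P * Q) x = LRhom P x * LRhom Q x"
  and LRhom_power: "LRhom (P ^ n) x = LRhom P x ^ n"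
  and LRhom_prod: "LRhom (\<Prod>i\<in>I. F i) x = (\<Prod>i\<in>I. LRhom (F i) x)"
  using pm_eval_hom.eval_single[OF LRhom_hom] pm_eval_hom.eval_zero[OF LRhom_hom]
    pm_eval_hom.eval_add[OF LRhom_hom] pm_eval_hom.eval_mult[OF LRhom_hom]
    pm_eval_hom.eval_power[OF LRhom_hom] pm_eval_hom.eval_prod[OF LRhom_hom]
  by (simp_all add: LRhom_eq)

lemma LRhom_const_L: "LRhom (const_L c) x = c"
  and LRhom_y_pow: "LRhom (y_pow v) x = cis (of_rat v * x)"
  by (simp_all add: const_L_def y_pow_def LRhom_single)

lemma LRhom_of_bipoly: "LRhom (of_bipoly F) x = bipoly_eval F (of_real x) (cis x)"
  by (induction F) (simp_all add: of_bipoly_0 LRhom_0 of_bipoly_pCons LRhom_add LRhom_mult LRhom_single LRhom_y_pow)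

lemma poly_map_poly_cnj: "poly (map_poly cnj p) (cnj z) = cnj (poly p z)"
  by (simp add: poly_altdef degree_map_poly coeff_map_poly)

lemma LRhom_con: "LRhom (con P) x = cnj (LRhom P x)"
proof (induction P rule: poly_mapping_single_induct)
  case (single v a P)
  have "con (Poly_Mapping.single v a + P) = Poly_Mapping.single (- v) (map_poly cnj a) + con P"
    by (simp add: con_eq con.eval_add mult_single)
  then show ?case
    using poly_map_poly_cnj[of a "of_real x"]
    by (simp add: LRhom_add LRhom_single single cis_cnj of_rat_minus)
qed (simp add: con_def LRhom_0)

lemma const_L_inject: "const_L c = const_L d \<longleftrightarrow> c = d"
  by (metis const_L_def lookup_single_eq pCons_eq_iff)

lemma const_L_y_pow: "const_L c * y_pow v = Poly_Mapping.single v [:c:]"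
  by (simp add: const_L_def y_pow_def mult_single)

text \<open>Inserting the conjugated relation into the original one gives
  \<open>U = const_L (c * cnj c) * U\<close>: the powers of y cancel.\<close>

lemma self_conj_norm:
  assumes eq: "U = const_L c * y_pow v * con U" and U: "U \<noteq> 0"
  shows "c * cnj c = 1"
proof -
  have "con U = const_L (cnj c) * y_pow (- v) * U"
    using arg_cong[OF eq, of con] by (simp add: con_mult con_const_L con_y_pow con_con)
  then have "U = const_L c * y_pow v * (const_L (cnj c) * y_pow (- v) * U)"
    using eq by simp
  also have "\<dots> = (const_L c * const_L (cnj c)) * (y_pow v * y_pow (- v)) * U"
    by (simp only: mult_ac)
  also have "\<dots> = const_L (c * cnj c) * U"
    by (simp flip: const_L_mult y_pow_add add: y_pow_0)
  finally have "1 * U = const_L (c * cnj c) * U" by simp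
  then have "const_L 1 = const_L (c * cnj c)" using U by (simp add: const_L_1)
  then show ?thesis by (simp add: const_L_inject)
qed

text \<open>\<open>c\<close> has norm 1, hence so does \<open>s\<close>, for either root, and
  \<open>cnj s = 1 / s\<close>. Conjugation therefore inverts the unit s y^(v/2), which is half of c
  y^v.\<close>

lemma con_normalized:
  assumes eq: "U = const_L c * y_pow v * con U" and U: "U \<noteq> 0" and s: "s\<^sup>2 = c"
  shows "con (U * y_pow (- v / 2) * const_L (1 / s)) = U * y_pow (- v / 2) * const_L (1 / s)"
proof -
  have cc: "c * cnj c = 1" by (rule self_conj_norm[OF eq U])
  have "norm s ^ 4 = norm (c * cnj c)"
    by (simp add: s[symmetric] norm_mult norm_power flip: power_add)
  then have "norm s ^ 4 = 1" by (simp add: cc)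
  then have "norm s = 1" using power_eq_1_iff[of "norm s" 4] by auto
  then have ss: "s * cnj s = 1" by (simp flip: complex_norm_square)
  have "con U = const_L (cnj c) * y_pow (- v) * U"
    using arg_cong[OF eq, of con] by (simp add: con_mult con_const_L con_y_pow con_con)
  then have "con (U * y_pow (- v / 2) * const_L (1 / s)) =
      U * (y_pow (- v) * y_pow (v / 2)) * (const_L (cnj c) * const_L (1 / cnj s))"
    by (simp add: con_mult con_const_L con_y_pow mult_ac)
  also have "\<dots> = U * y_pow (- v / 2) * const_L (cnj c * (1 / cnj s))"
    by (simp flip: const_L_mult y_pow_add)
  also have "cnj c * (1 / cnj s) = 1 / s"
  proof -
    have "cnj s \<noteq> 0" "s \<noteq> 0" using ss by auto
    then show ?thesis using ss by (simp add: s[symmetric] power2_eq_square field_simps)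
  qed
  finally show ?thesis .
qed

lemma self_conj_factor:
  assumes P: "P \<noteq> 0" "P = con P"
    and fact: "P = const_L C * y_pow (of_int p) * (\<Prod>i\<in>I. of_bipoly (Q i) ^ r i)"
    and fin: "finite I" and r: "\<And>i. i \<in> I \<Longrightarrow> r i \<ge> (1::nat)" "inj_on r I"
    and sqf: "\<And>i. i \<in> I \<Longrightarrow> squarefree (Q i)"
    and cop: "\<And>i j. i \<in> I \<Longrightarrow> j \<in> I \<Longrightarrow> i \<noteq> j \<Longrightarrow> coprime (Q i) (Q j)"
    and nz: "\<And>i. i \<in> I \<Longrightarrow> Q i \<noteq> 0" and i: "i \<in> I"
  shows "\<exists>c (q::int). of_bipoly (Q i) = const_L c * y_pow (of_int q) * con (of_bipoly (Q i))"
proof -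
  have C0: "C \<noteq> 0" using P(1) fact by (auto simp: const_L_def)
  define d where "d = (\<Sum>i\<in>I. r i * degree (Q i))"
  \<comment> \<open>The exponent of y in \<open>con P\<close>: conjugation negates \<open>p\<close>,
    and each reflection contributes minus the degree of its factor, with multiplicity.\<close>
  define e where "e = - p - int d"
  \<comment> \<open>Multiplication by y^N makes both exponents nonnegative, so the equation can be
    read among polynomials.\<close>
  define N where "N = \<bar>p\<bar> + \<bar>e\<bar>"
  define a where "a = nat (p + N)"
  define b where "b = nat (e + N)"
  have ab: "(of_nat a :: rat) = of_int (p + N)" "(of_nat b :: rat) = of_int (e + N)"
    by (auto simp: a_def b_def N_def of_nat_nat)
  have *: "const_L C * y_pow (of_int p) * of_bipoly (\<Prod>i\<in>I. Q i ^ r i) =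
      const_L (cnj C) * y_pow (of_int e) * of_bipoly (\<Prod>i\<in>I. conj_reflect (Q i) ^ r i)"
  proof -
    have "(\<Prod>i\<in>I. con (of_bipoly (Q i)) ^ r i) =
        (\<Prod>i\<in>I. y_pow (- (of_nat (r i * degree (Q i)))) * of_bipoly (conj_reflect (Q i) ^ r i))"
      by (intro prod.cong refl) (simp add: con_of_bipoly power_mult_distrib y_pow_power of_bipoly_power)
    also have "\<dots> = y_pow (- of_nat d) * of_bipoly (\<Prod>i\<in>I. conj_reflect (Q i) ^ r i)"
      by (simp add: prod.distrib y_pow_prod sum_negf d_def of_bipoly_prod)
    finally have "con P = const_L (cnj C) * (y_pow (- of_int p) * y_pow (- of_nat d)) *
        of_bipoly (\<Prod>i\<in>I. conj_reflect (Q i) ^ r i)"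
      by (subst fact) (simp add: con_mult con_const_L con_y_pow con_prod con_power mult_ac)
    then show ?thesis
      using P(2) fact by (simp add: e_def of_bipoly_prod of_bipoly_power flip: y_pow_add)
  qed
  have "of_bipoly (monom 1 a * (Polynomial.smult [:C:] (\<Prod>i\<in>I. Q i ^ r i))) =
      y_pow (of_int N) * (const_L C * y_pow (of_int p) * of_bipoly (\<Prod>i\<in>I. Q i ^ r i))"
    by (simp add: of_bipoly_mult of_bipoly_monom of_bipoly_smult const_L_def[symmetric] ab y_pow_add mult_ac)
  also have "\<dots> = of_bipoly (monom 1 b * (Polynomial.smult [:cnj C:] (\<Prod>i\<in>I. conj_reflect (Q i) ^ r i)))"
    unfolding * by (simp add: of_bipoly_mult of_bipoly_monom of_bipoly_smult const_L_def[symmetric] ab y_pow_add mult_ac)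
  finally have peq: "monom 1 a * (Polynomial.smult [:C:] (\<Prod>i\<in>I. Q i ^ r i)) =
      monom 1 b * (Polynomial.smult [:cnj C:] (\<Prod>i\<in>I. conj_reflect (Q i) ^ r i))"
    by (simp only: of_bipoly_inject)
  have "cnj C \<noteq> 0" using C0 by simp
  then obtain w k where w: "w \<noteq> 0" "monom 1 k * conj_reflect (Q i) = Polynomial.smult [:w:] (Q i)"
    using conj_reflect_factor[where Q = Q, OF fin nz C0 _ peq r sqf cop i] by blast
  have "const_L (1 / w) * y_pow (of_int (int k + int (degree (Q i)))) * con (of_bipoly (Q i)) =
      const_L (1 / w) * (y_pow (of_nat k) * (y_pow (of_nat (degree (Q i))) * y_pow (- of_nat (degree (Q i))))
        * of_bipoly (conj_reflect (Q i)))"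
    by (simp add: con_of_bipoly y_pow_add mult_ac)
  also have "\<dots> = const_L (1 / w) * of_bipoly (monom 1 k * conj_reflect (Q i))"
    by (simp add: of_bipoly_mult of_bipoly_monom y_pow_0 flip: y_pow_add)
  also have "\<dots> = (const_L (1 / w) * const_L w) * of_bipoly (Q i)"
    unfolding w(2) of_bipoly_smult const_L_def[of w, symmetric] by (simp only: mult.assoc)
  also have "\<dots> = of_bipoly (Q i)" using w(1) by (simp add: const_L_1 flip: const_L_mult)
  finally show ?thesis by metis
qed

text \<open>Replacing each \<open>U i\<close> by its conjugate form and cancelling the product of
  the conjugates in \<open>P = con P\<close> leaves an equation of monomials, so p + V = - p for V
  the sum of the \<open>r i * v i\<close>. Thus the half exponents \<open>- v i / 2\<close> add up,
  with multiplicity, to \<open>p\<close>.\<close>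

lemma self_conj_prod_normalized:
  assumes P: "P \<noteq> 0" "P = con P" and fact: "P = const_L C * y_pow p * (\<Prod>i\<in>I. U i ^ r i)"
    and eq: "\<And>i. i \<in> I \<Longrightarrow> U i = const_L (c i) * y_pow (v i) * con (U i)"
    and s: "\<And>i. i \<in> I \<Longrightarrow> s i \<noteq> 0"
  shows "P = const_L (C * (\<Prod>i\<in>I. s i ^ r i)) *
    (\<Prod>i\<in>I. (U i * y_pow (- v i / 2) * const_L (1 / s i)) ^ r i)"
proof -
  define V where "V = (\<Sum>i\<in>I. of_nat (r i) * v i)"
  define X where "X = (\<Prod>i\<in>I. con (U i) ^ r i)"
  define c' where "c' = C * (\<Prod>i\<in>I. c i ^ r i)"
  have cP: "con P = const_L (cnj C) * y_pow (- p) * X"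
    by (subst fact) (simp add: con_mult con_const_L con_y_pow con_prod con_power X_def)
  have "(\<Prod>i\<in>I. U i ^ r i) = (\<Prod>i\<in>I. const_L (c i ^ r i) * y_pow (of_nat (r i) * v i) * con (U i) ^ r i)"
  proof (rule prod.cong[OF refl])
    fix i assume "i \<in> I"
    show "U i ^ r i = const_L (c i ^ r i) * y_pow (of_nat (r i) * v i) * con (U i) ^ r i"
      by (subst eq[OF \<open>i \<in> I\<close>]) (simp add: power_mult_distrib const_L_power y_pow_power)
  qed
  also have "\<dots> = const_L (\<Prod>i\<in>I. c i ^ r i) * y_pow V * X"
    by (simp add: prod.distrib const_L_prod y_pow_prod V_def X_def)
  finally have "P = const_L c' * y_pow (p + V) * X"
    by (subst fact) (simp add: c'_def const_L_mult y_pow_add mult_ac)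
  then have "const_L c' * y_pow (p + V) * X = const_L (cnj C) * y_pow (- p) * X"
    using P(2) cP by simp
  moreover have "X \<noteq> 0" using P cP by auto
  ultimately have "Poly_Mapping.single (p + V) [:c':] = Poly_Mapping.single (- p) [:cnj C:]"
    by (simp add: const_L_y_pow)
  moreover have "C \<noteq> 0" using P(1) fact by (auto simp: const_L_def)
  ultimately have "p + V = - p"
    by (metis complex_cnj_zero_iff lookup_single_eq lookup_single_not_eq pCons_eq_0_iff)
  then have "- V / 2 = p" by simp
  then have pV: "(\<Sum>i\<in>I. - (of_nat (r i) * v i) / 2) = p"
    by (simp add: V_def sum_divide_distrib sum_negf)
  have "(\<Prod>i\<in>I. (U i * y_pow (- v i / 2) * const_L (1 / s i)) ^ r i) =
      (\<Prod>i\<in>I. U i ^ r i * y_pow (- (of_nat (r i) * v i) / 2) * const_L ((1 / s i) ^ r i))"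
    by (intro prod.cong refl) (simp add: power_mult_distrib y_pow_power const_L_power)
  also have "\<dots> = (\<Prod>i\<in>I. U i ^ r i) * y_pow p * const_L (\<Prod>i\<in>I. (1 / s i) ^ r i)"
    by (simp only: prod.distrib y_pow_prod const_L_prod pV)
  also have "const_L (C * (\<Prod>i\<in>I. s i ^ r i)) * \<dots> =
      (const_L C * const_L ((\<Prod>i\<in>I. s i ^ r i) * (\<Prod>i\<in>I. (1 / s i) ^ r i))) * y_pow p * (\<Prod>i\<in>I. U i ^ r i)"
    by (simp add: const_L_mult mult_ac)
  also have "(\<Prod>i\<in>I. s i ^ r i) * (\<Prod>i\<in>I. (1 / s i) ^ r i) = 1"
    using s by (simp flip: prod.distrib power_mult_distrib)
  finally show ?thesis using fact by (simp add: const_L_1)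
qed

text \<open>Up to a power of y, \<open>P\<close> is the polynomial \<open>F\<close>, which has the
  same coefficients. \<open>C\<close> stays inside \<open>F\<close>, because only the whole product
  is known to have algebraic coefficients.\<close>

lemma algebraic_coeffs_factor:
  assumes P: "P \<noteq> 0" "algebraic_coeffs P"
    and fact: "P = const_L C * y_pow p * (\<Prod>i\<in>I. of_bipoly (Q i) ^ r i)"
    and fin: "finite I" and i: "i \<in> I" "r i \<ge> (1::nat)"
  obtains c where "c \<noteq> 0" "algebraic_bipoly (Polynomial.smult [:c:] (Q i))"
proof -
  define F where "F = Polynomial.smult [:C:] (\<Prod>i\<in>I. Q i ^ r i)"
  have "of_bipoly F = const_L C * (\<Prod>i\<in>I. of_bipoly (Q i) ^ r i)"
    by (simp add: F_def of_bipoly_smult of_bipoly_prod of_bipoly_power const_L_def)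
  then have PF: "P = y_pow p * of_bipoly F" by (simp add: fact mult_ac)
  then have F0: "F \<noteq> 0" using P(1) by (auto simp: of_bipoly_0)
  have "P * y_pow (- p) = of_bipoly F * (y_pow p * y_pow (- p))" by (simp add: PF mult_ac)
  also have "\<dots> = of_bipoly F" by (simp add: y_pow_0 flip: y_pow_add)
  finally have "of_bipoly F = P * Poly_Mapping.single (- p) 1" by (simp add: y_pow_def)
  then have "coeff F k = Poly_Mapping.lookup P (of_nat k + p)" for k
    using lookup_of_bipoly[of F k] by (simp add: lookup_times_single)
  then have "algebraic_bipoly F"
    using P(2) by (simp add: algebraic_bipoly_def algebraic_poly_def algebraic_coeffs_def)
  moreover have "Q i dvd F"
  proof -
    have "Q i dvd Q i ^ r i" using i(2) by (simp add: dvd_power)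
    also have "Q i ^ r i dvd (\<Prod>i\<in>I. Q i ^ r i)" using fin i(1) by (rule dvd_prodI)
    finally show ?thesis unfolding F_def by (rule dvd_smult)
  qed
  ultimately show ?thesis using algebraic_bipoly_factor[OF _ F0] that by blast
qed

lemma smult_const_dvd: "c \<noteq> 0 \<Longrightarrow> Polynomial.smult [:c:] F dvd F" for F :: "complex poly poly"
  by (rule dvdI[of _ _ "[:[:1 / c:]:]"]) (simp flip: one_pCons)

lemma normalized_multiple_root:
  assumes s: "s \<noteq> 0" and alg: "algebraic_bipoly (Polynomial.smult [:c:] F)" "c \<noteq> 0"
    and F: "squarefree F" "F \<noteq> 0"
    and root: "multiple_root (LRhom (of_bipoly F * y_pow v * const_L (1 / s))) x"
  shows "x = 0"
proof (rule squarefree_multiple_zero[OF alg(1)])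
  let ?f = "LRhom (of_bipoly F * y_pow v * const_L (1 / s))"
  \<comment> \<open>A nowhere vanishing factor that removes the half-integral power of y. At a zero
    of \<open>?f\<close> with derivative 0 the product also has derivative 0, whatever that of
    \<open>k\<close> is.\<close>
  define k where "k x = s * cis (- of_rat v * x)" for x
  have fk: "?f x * k x = bipoly_eval F (of_real x) (cis x)" for x
    using s by (simp add: LRhom_mult LRhom_of_bipoly LRhom_y_pow LRhom_const_L k_def cis_mult mult_ac)
  have f0: "?f x = 0" "(?f has_vector_derivative 0) (at x)" using root by (auto simp: multiple_root_def)
  obtain k' where k': "(k has_vector_derivative k') (at x)"
  proof
    show "(k has_vector_derivative s * (- of_rat v *\<^sub>R (\<i> * cis (- of_rat v * x)))) (at x)"
      unfolding k_def has_vector_derivative_def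
      by (auto intro!: derivative_eq_intros simp: scaleR_conv_of_real algebra_simps)
  qed
  have "((\<lambda>x. ?f x * k x) has_vector_derivative 0) (at x)"
    using has_vector_derivative_mult[OF f0(2) k'] f0(1) by simp
  then have "bipoly_eval (cis_deriv F) (of_real x) (cis x) = 0"
    using cis_deriv_has_vector_derivative[of F x] has_derivative_unique
    unfolding fk has_vector_derivative_def by (metis scaleR_one)
  then show "bipoly_eval (cis_deriv (Polynomial.smult [:c:] F)) (of_real x) (cis x) = 0"
    by (simp add: cis_deriv_smult)
  have "bipoly_eval F (of_real x) (cis x) = 0" using fk[of x] f0(1) by simp
  then show "bipoly_eval (Polynomial.smult [:c:] F) (of_real x) (cis x) = 0" by simp
  show "squarefree (Polynomial.smult [:c:] F)"
    using squarefree_mono[OF smult_const_dvd F(1)] alg(2) by blast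
  show "Polynomial.smult [:c:] F \<noteq> 0" using F(2) alg(2) by simp
qed

lemma normalized_root:
  assumes "s \<noteq> 0" "LRhom (of_bipoly F * y_pow v * const_L (1 / s)) x = 0"
  shows "bipoly_eval F (of_real x) (cis x) = 0"
  using assms by (simp add: LRhom_mult LRhom_of_bipoly LRhom_y_pow LRhom_const_L)

theorem theorem3p2:
  fixes P :: gen_laurent and C :: complex and p :: int and n :: nat
    and Q :: "nat \<Rightarrow> complex poly poly" and r :: "nat \<Rightarrow> nat"
  assumes "P \<in> laurent_polys" and "P \<noteq> 0" and "P = con P"
    and "P = const_L C * y_pow (of_int p) * (\<Prod>i=1..n. of_bipoly (Q i) ^ r i)"
    and "\<forall>i\<in>{1..n}. r i \<ge> 1" and "inj_on r {1..n}"
    and "\<forall>i\<in>{1..n}. squarefree (Q i)"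
    and "pairwise (\<lambda>i j. coprime (Q i) (Q j)) {1..n}"
  shows "\<exists>(c :: nat \<Rightarrow> complex) (q :: nat \<Rightarrow> int).
    (\<forall>i\<in>{1..n}. of_bipoly (Q i) = const_L (c i) * y_pow (of_int (q i)) * con (of_bipoly (Q i))) \<and>
    (\<forall>s :: nat \<Rightarrow> complex. (\<forall>i\<in>{1..n}. (s i)\<^sup>2 = c i) \<longrightarrow>
      (let f = (\<lambda>i. LRhom (of_bipoly (Q i) * y_pow (- of_int (q i) / 2) * const_L (1 / s i)));
           C0 = C * (\<Prod>i=1..n. s i ^ r i)
       in (\<forall>i\<in>{1..n}. (\<forall>x. f i x \<in> \<real>) \<or> (\<forall>x. Re (f i x) = 0)) \<and>
          (algebraic_coeffs P \<longrightarrow>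
            (\<forall>i\<in>{1..n}. \<forall>x. multiple_root (f i) x \<longrightarrow> x = 0) \<and>
            (\<forall>i\<in>{1..n}. \<forall>j\<in>{1..n}. i \<noteq> j \<longrightarrow> (\<forall>x. f i x = 0 \<and> f j x = 0 \<longrightarrow> x = 0))) \<and>
          (\<forall>x. LRhom P x = C0 * (\<Prod>i=1..n. f i x ^ r i))))"
proof -
  let ?I = "{1..n}" and ?U = "\<lambda>i. of_bipoly (Q i)"
  note P = assms(2,3) and fact = assms(4)
  have r: "r i \<ge> 1" if "i \<in> ?I" for i using assms(5) that by blast
  have sqf: "squarefree (Q i)" if "i \<in> ?I" for i using assms(7) that by blast
  have cop: "coprime (Q i) (Q j)" if "i \<in> ?I" "j \<in> ?I" "i \<noteq> j" for i j
    using assms(8) that by (auto simp: pairwise_def)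
  have U0: "?U i \<noteq> 0" if "i \<in> ?I" for i
  proof
    assume "?U i = 0"
    then have "\<exists>i\<in>?I. ?U i ^ r i = 0" using that r[OF that] by (intro bexI[of _ i]) auto
    then have "(\<Prod>i=1..n. ?U i ^ r i) = 0" by (intro prod_zero) auto
    then show False using P(1) fact by simp
  qed
  have Q0: "Q i \<noteq> 0" if "i \<in> ?I" for i using U0[OF that] by (auto simp: of_bipoly_0)
  have "\<exists>c (q::int). ?U i = const_L c * y_pow (of_int q) * con (?U i)" if "i \<in> ?I" for i
    by (rule self_conj_factor[OF P fact _ r assms(6) sqf cop Q0 that]) simp_all
  then have "\<forall>i\<in>?I. \<exists>c (q::int). ?U i = const_L c * y_pow (of_int q) * con (?U i)" by blast
  then obtain c and q :: "nat \<Rightarrow> int" where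
    eq: "\<And>i. i \<in> ?I \<Longrightarrow> ?U i = const_L (c i) * y_pow (of_int (q i)) * con (?U i)"
    unfolding bchoice_iff by blast
  show ?thesis
  proof (intro exI[of _ c] exI[of _ q] conjI ballI allI impI)
    show "?U i = const_L (c i) * y_pow (of_int (q i)) * con (?U i)" if "i \<in> ?I" for i
      by (rule eq[OF that])
    fix s :: "nat \<Rightarrow> complex"
    assume s: "\<forall>i\<in>?I. (s i)\<^sup>2 = c i"
    define W where "W i = ?U i * y_pow (- of_int (q i) / 2) * const_L (1 / s i)" for i
    have s0: "s i \<noteq> 0" if "i \<in> ?I" for i
    proof
      assume "s i = 0"
      then have "c i = 0" using s that by force
      then show False using self_conj_norm[OF eq[OF that] U0[OF that]] by simp
    qed
    \<comment> \<open>A fixed point of \<open>con\<close> takes real values; either choice of the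
      root \<open>s i\<close> is allowed, since it changes \<open>W i\<close> only by a
      sign.\<close>
    have real: "LRhom (W i) x \<in> \<real>" if "i \<in> ?I" for i x
    proof -
      have "con (W i) = W i"
        unfolding W_def using con_normalized[OF eq[OF that] U0[OF that]] s that by blast
      then have "cnj (LRhom (W i) x) = LRhom (W i) x" by (metis LRhom_con)
      then show ?thesis by (simp add: Reals_cnj_iff)
    qed
    have mult: "x = 0"
      if "algebraic_coeffs P" and i: "i \<in> ?I" and root: "multiple_root (LRhom (W i)) x" for i x
    proof -
      obtain a where a: "a \<noteq> 0" "algebraic_bipoly (Polynomial.smult [:a:] (Q i))"
        using algebraic_coeffs_factor[OF P(1) \<open>algebraic_coeffs P\<close> fact _ i r[OF i]] by auto
      show ?thesis
        using normalized_multiple_root[OF s0[OF i] a(2,1) sqf[OF i] Q0[OF i]] root by (simp add: W_def)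
    qed
    have common: "x = 0"
      if "algebraic_coeffs P" and i: "i \<in> ?I" and j: "j \<in> ?I" "i \<noteq> j"
        and root: "LRhom (W i) x = 0" "LRhom (W j) x = 0" for i j x
    proof -
      obtain a where a: "a \<noteq> 0" "algebraic_bipoly (Polynomial.smult [:a:] (Q i))"
        using algebraic_coeffs_factor[OF P(1) \<open>algebraic_coeffs P\<close> fact _ i r[OF i]] by auto
      obtain b where b: "b \<noteq> 0" "algebraic_bipoly (Polynomial.smult [:b:] (Q j))"
        using algebraic_coeffs_factor[OF P(1) \<open>algebraic_coeffs P\<close> fact _ j(1) r[OF j(1)]] by auto
      \<comment> \<open>The constants that make the two factors algebraic may differ; scaling by
        them keeps coprimality.\<close>
      have "coprime (Polynomial.smult [:a:] (Q i)) (Polynomial.smult [:b:] (Q j))"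
        by (rule coprime_divisors[OF smult_const_dvd[OF a(1)] smult_const_dvd[OF b(1)] cop[OF i j]])
      then show ?thesis
        using coprime_common_zero[OF a(2) b(2), of x] root normalized_root[OF s0[OF i]] normalized_root[OF s0[OF j(1)]]
        by (simp add: W_def)
    qed
    have "P = const_L (C * (\<Prod>i=1..n. s i ^ r i)) * (\<Prod>i=1..n. W i ^ r i)"
      unfolding W_def by (rule self_conj_prod_normalized[OF P fact eq s0])
    from arg_cong[OF this, of "\<lambda>P. LRhom P _"]
    have "LRhom P x = C * (\<Prod>i=1..n. s i ^ r i) * (\<Prod>i=1..n. LRhom (W i) x ^ r i)" for x
      by (simp only: LRhom_const_L LRhom_mult LRhom_power LRhom_prod)
    then show "let f = (\<lambda>i. LRhom (of_bipoly (Q i) * y_pow (- of_int (q i) / 2) * const_L (1 / s i)));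
           C0 = C * (\<Prod>i=1..n. s i ^ r i)
       in (\<forall>i\<in>{1..n}. (\<forall>x. f i x \<in> \<real>) \<or> (\<forall>x. Re (f i x) = 0)) \<and>
          (algebraic_coeffs P \<longrightarrow>
            (\<forall>i\<in>{1..n}. \<forall>x. multiple_root (f i) x \<longrightarrow> x = 0) \<and>
            (\<forall>i\<in>{1..n}. \<forall>j\<in>{1..n}. i \<noteq> j \<longrightarrow> (\<forall>x. f i x = 0 \<and> f j x = 0 \<longrightarrow> x = 0))) \<and>
          (\<forall>x. LRhom P x = C0 * (\<Prod>i=1..n. f i x ^ r i))"
      unfolding Let_def W_def[symmetric] using real mult common by blast
  qed
qed

end
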